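(* Let $n\geq 2$ and let $\Bbbk$ be any (nontrivial) commutative ring. The repetitive quiver of $\vec{\mathbb{A}}_n$, regarded as a stable translation quiver, is normal (relative to $\Bbbk$); that is, with $Q$ its mesh category over $\Bbbk$, the mesh homology satisfies $\mathscr{H}_y(Q(x,-))=0$ for all vertices $x,y$.
   Context: $\vec{\mathbb{A}}_n$ is the quiver with vertices $1,\dots,n$ and arrows $a_q\colon q\to q+1$ for $1\leq q<n$. Its repetitive quiver has vertices $(q,i)$ with $1\leq q\leq n$, $i\in\mathbb{Z}$, and arrows $a_{q,i}\colon(q,i)\to(q+1,i)$ and $a^*_{q,i}\colon(q+1,i)\to(q,i-1)$ for $1\leq q<n$, $i\in\mathbb{Z}$. It is a stable translation quiver with translation $\tau(q,i)=(q,i+1)$ and semitranslation $\sigma(a_{q,i})=a^*_{q,i+1}$, $\sigma(a^*_{q,i})=a_{q,i}$. The path category over $\Bbbk$ has the vertices as objects, and hom modules are the free $\Bbbk$-modules on the sets of paths (including trivial ones; paths are composed right to left). The mesh category $Q$ is the quotient of the path category by the two-sided ideal generated by the mesh relations, for all $i\in\mathbb{Z}$, $$\mu_{(1,i)}=a^*_{1,i+1}a_{1,i+1},\quad \mu_{(q,i)}=a_{q-1,i}a^*_{q-1,i+1}+a^*_{q,i+1}a_{q,i+1}\ (1<q<n),\quad \mu_{(n,i)}=a_{n-1,i}a^*_{n-1,i+1}.$$ For a $\Bbbk$-linear functor $X$ from $Q$ to $\Bbbk$-modules and a vertex $y$, let $b_1\colon p_1\to y,\dots,b_m\colon p_m\to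 y$ be all the arrows with target $y$. The mesh homology $\mathscr{H}_y(X)$ is the homology (at the middle term) of the three term complex $$X(\tau(y))\xrightarrow{\ (X(\sigma(b_1)),\dots,X(\sigma(b_m)))^{t}\ }X(p_1)\oplus\cdots\oplus X(p_m)\xrightarrow{\ (X(b_1)\ \cdots\ X(b_m))\ }X(y).$$ *)

theory Defs
  imports "HOL-Algebra.Module" "HOL-Algebra.AbelCoset" "Graph_Theory.Arc_Walk"
begin

section \<open>Modules\<close>

text \<open>
  The record \<^type>\<open>module\<close> extends the ring record, so it has fields for a multiplication and a
  unit. These play no role in a module and are left undefined below.
\<close>

text \<open>The free module on a set is realised by the finitely supported functions that vanish
  outside of the set.\<close>

definition free_module :: "('k, 'r) ring_scheme \<Rightarrow> 's set \<Rightarrow> ('k, 's \<Rightarrow> 'k) module" where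
  "free_module R S = \<lparr>
     carrier = {f. range f \<subseteq> carrier R \<and> finite {s. f s \<noteq> \<zero>\<^bsub>R\<^esub>} \<and> {s. f s \<noteq> \<zero>\<^bsub>R\<^esub>} \<subseteq> S},
     mult = undefined, one = undefined,
     zero = (\<lambda>s. \<zero>\<^bsub>R\<^esub>), add = (\<lambda>f g s. f s \<oplus>\<^bsub>R\<^esub> g s),
     smult = (\<lambda>r f s. r \<otimes>\<^bsub>R\<^esub> f s)\<rparr>"

definition basis_elem :: "('k, 'r) ring_scheme \<Rightarrow> 's \<Rightarrow> 's \<Rightarrow> 'k" where
  "basis_elem R s = (\<lambda>t. if t = s then \<one>\<^bsub>R\<^esub> else \<zero>\<^bsub>R\<^esub>)"

text \<open>The direct sum of a family of modules indexed by a finite set \<open>B\<close>.\<close>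

definition direct_sum :: "'b set \<Rightarrow> ('b \<Rightarrow> ('k, 'v) module) \<Rightarrow> ('k, 'b \<Rightarrow> 'v) module" where
  "direct_sum B M = \<lparr>
     carrier = (\<Pi>\<^sub>E b\<in>B. carrier (M b)),
     mult = undefined, one = undefined,
     zero = (\<lambda>b\<in>B. \<zero>\<^bsub>M b\<^esub>), add = (\<lambda>f g. \<lambda>b\<in>B. f b \<oplus>\<^bsub>M b\<^esub> g b),
     smult = (\<lambda>r f. \<lambda>b\<in>B. r \<odot>\<^bsub>M b\<^esub> f b)\<rparr>"

definition quotient_module :: "('k, 'v) module \<Rightarrow> 'v set \<Rightarrow> ('k, 'v set) module" where
  "quotient_module M N = \<lparr>
     carrier = a_rcosets\<^bsub>M\<^esub> N,
     mult = undefined, one = undefined,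
     zero = N, add = set_add M,
     smult = (\<lambda>r A. \<Union>a\<in>A. N +>\<^bsub>M\<^esub> (r \<odot>\<^bsub>M\<^esub> a))\<rparr>"

text \<open>The homology of \<open>L \<rightarrow> M \<rightarrow> N\<close> at \<open>M\<close>, where the maps are \<open>u\<close> and \<open>v\<close>.\<close>

definition homology :: "('k, 'u) module \<Rightarrow> ('k, 'v) module \<Rightarrow> ('k, 'w) module
    \<Rightarrow> ('u \<Rightarrow> 'v) \<Rightarrow> ('v \<Rightarrow> 'w) \<Rightarrow> ('k, 'v set) module" where
  "homology L M N u v = quotient_module (M\<lparr>carrier := a_kernel M N v\<rparr>) (u ` carrier L)"


section \<open>Linear categories, ideals and functors\<close>

text \<open>\<open>Comp C x y z g f\<close> is the composite of \<open>f \<in> Hom C x y\<close> and \<open>g \<in> Hom C y z\<close>.\<close>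

record ('o, 'k, 'm) linear_cat =
  Ob :: "'o set"
  Hom :: "'o \<Rightarrow> 'o \<Rightarrow> ('k, 'm) module"
  Comp :: "'o \<Rightarrow> 'o \<Rightarrow> 'o \<Rightarrow> 'm \<Rightarrow> 'm \<Rightarrow> 'm"
  Idm :: "'o \<Rightarrow> 'm"

text \<open>The two-sided ideal generated by a family of subsets \<open>G x y\<close> of the hom modules; it
  consists of the submodules \<open>{f. two_sided_ideal R C G x y f}\<close> of \<open>Hom C x y\<close>.\<close>

inductive two_sided_ideal ::
    "('k, 'r) ring_scheme \<Rightarrow> ('o, 'k, 'm) linear_cat \<Rightarrow> ('o \<Rightarrow> 'o \<Rightarrow> 'm set)
      \<Rightarrow> 'o \<Rightarrow> 'o \<Rightarrow> 'm \<Rightarrow> bool"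
  for R :: "('k, 'r) ring_scheme" and C :: "('o, 'k, 'm) linear_cat"
    and G :: "'o \<Rightarrow> 'o \<Rightarrow> 'm set" where
  generator: "x \<in> Ob C \<Longrightarrow> y \<in> Ob C \<Longrightarrow> f \<in> G x y \<Longrightarrow> two_sided_ideal R C G x y f"
| zero: "x \<in> Ob C \<Longrightarrow> y \<in> Ob C \<Longrightarrow> two_sided_ideal R C G x y \<zero>\<^bsub>Hom C x y\<^esub>"
| add: "two_sided_ideal R C G x y f \<Longrightarrow> two_sided_ideal R C G x y g
    \<Longrightarrow> two_sided_ideal R C G x y (f \<oplus>\<^bsub>Hom C x y\<^esub> g)"
| smult: "r \<in> carrier R \<Longrightarrow> two_sided_ideal R C G x y f
    \<Longrightarrow> two_sided_ideal R C G x y (r \<odot>\<^bsub>Hom C x y\<^esub> f)"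
| comp_left: "two_sided_ideal R C G x y f \<Longrightarrow> z \<in> Ob C \<Longrightarrow> g \<in> carrier (Hom C y z)
    \<Longrightarrow> two_sided_ideal R C G x z (Comp C x y z g f)"
| comp_right: "two_sided_ideal R C G y z g \<Longrightarrow> x \<in> Ob C \<Longrightarrow> f \<in> carrier (Hom C x y)
    \<Longrightarrow> two_sided_ideal R C G x z (Comp C x y z g f)"

definition quotient_cat ::
    "('o, 'k, 'm) linear_cat \<Rightarrow> ('o \<Rightarrow> 'o \<Rightarrow> 'm set) \<Rightarrow> ('o, 'k, 'm set) linear_cat" where
  "quotient_cat C I = \<lparr>
     Ob = Ob C,
     Hom = (\<lambda>x y. quotient_module (Hom C x y) (I x y)),
     Comp = (\<lambda>x y z B A. \<Union>g\<in>B. \<Union>f\<in>A. I x z +>\<^bsub>Hom C x z\<^esub> Comp C x y z g f),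
     Idm = (\<lambda>x. I x x +>\<^bsub>Hom C x x\<^esub> Idm C x)\<rparr>"

text \<open>The data of a linear functor to modules: \<open>FMor X x y f\<close> is the map
  \<open>FOb X x \<rightarrow> FOb X y\<close> induced by \<open>f \<in> Hom C x y\<close>.\<close>

record ('o, 'm, 'k, 'v) module_functor =
  FOb :: "'o \<Rightarrow> ('k, 'v) module"
  FMor :: "'o \<Rightarrow> 'o \<Rightarrow> 'm \<Rightarrow> 'v \<Rightarrow> 'v"

definition representable :: "('o, 'k, 'm) linear_cat \<Rightarrow> 'o \<Rightarrow> ('o, 'm, 'k, 'm) module_functor" where
  "representable C x = \<lparr>FOb = Hom C x, FMor = Comp C x\<rparr>"


section \<open>Path categories\<close>

text \<open>
  A quiver is a \<^type>\<open>pre_digraph\<close>. A path is represented by the list of its arrows in the order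
  in which they are traversed, so the composite of the path \<open>q\<close> after the path \<open>p\<close> is \<open>p @ q\<close>.
  The bilinear extension of this composition to linear combinations is the convolution
  \<open>(g f)(r) = \<Sum>\<^bsub>p @ q = r\<^esub> g(q) f(p)\<close>.
\<close>

definition path_category ::
    "('k, 'r) ring_scheme \<Rightarrow> ('a, 'b) pre_digraph \<Rightarrow> ('a, 'k, 'b list \<Rightarrow> 'k) linear_cat" where
  "path_category R G = \<lparr>
     Ob = verts G,
     Hom = (\<lambda>x y. free_module R {p. pre_digraph.awalk G x p y}),
     Comp = (\<lambda>x y z g f r. \<Oplus>\<^bsub>R\<^esub> k \<in> {..length r}. g (drop k r) \<otimes>\<^bsub>R\<^esub> f (take k r)),
     Idm = (\<lambda>x. basis_elem R [])\<rparr>"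


section \<open>Stable translation quivers and mesh homology\<close>

record ('a, 'b) translation_quiver =
  quiver :: "('a, 'b) pre_digraph"
  translation :: "'a \<Rightarrow> 'a"
  semitranslation :: "'b \<Rightarrow> 'b"

locale stable_translation_quiver =
  fixes \<Gamma> :: "('a, 'b) translation_quiver"
  assumes wf_digraph: "wf_digraph (quiver \<Gamma>)"
    and finite_in_arcs: "y \<in> verts (quiver \<Gamma>) \<Longrightarrow> finite (in_arcs (quiver \<Gamma>) y)"
    and finite_out_arcs: "y \<in> verts (quiver \<Gamma>) \<Longrightarrow> finite (out_arcs (quiver \<Gamma>) y)"
    and bij_translation: "bij_betw (translation \<Gamma>) (verts (quiver \<Gamma>)) (verts (quiver \<Gamma>))"
    and bij_semitranslation: "bij_betw (semitranslation \<Gamma>) (arcs (quiver \<Gamma>)) (arcs (quiver \<Gamma>))"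
    and tail_semitranslation:
      "b \<in> arcs (quiver \<Gamma>) \<Longrightarrow>
        tail (quiver \<Gamma>) (semitranslation \<Gamma> b) = translation \<Gamma> (head (quiver \<Gamma>) b)"
    and head_semitranslation:
      "b \<in> arcs (quiver \<Gamma>) \<Longrightarrow>
        head (quiver \<Gamma>) (semitranslation \<Gamma> b) = tail (quiver \<Gamma>) b"

text \<open>The mesh relation of \<open>y\<close> is the sum of the paths
  \<open>\<tau> y \<rightarrow> p \<rightarrow> y\<close> given by \<open>\<sigma> b\<close> followed by \<open>b\<close>, over all arrows \<open>b : p \<rightarrow> y\<close>.\<close>

definition mesh_relation ::
    "('k, 'r) ring_scheme \<Rightarrow> ('a, 'b) translation_quiver \<Rightarrow> 'a \<Rightarrow> 'b list \<Rightarrow> 'k" where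
  "mesh_relation R \<Gamma> y =
     (\<Oplus>\<^bsub>Hom (path_category R (quiver \<Gamma>)) (translation \<Gamma> y) y\<^esub> b \<in> in_arcs (quiver \<Gamma>) y.
        basis_elem R [semitranslation \<Gamma> b, b])"

definition mesh_ideal ::
    "('k, 'r) ring_scheme \<Rightarrow> ('a, 'b) translation_quiver \<Rightarrow> 'a \<Rightarrow> 'a \<Rightarrow> ('b list \<Rightarrow> 'k) set" where
  "mesh_ideal R \<Gamma> x y = Collect
     (two_sided_ideal R (path_category R (quiver \<Gamma>))
       (\<lambda>x y. if x = translation \<Gamma> y then {mesh_relation R \<Gamma> y} else {}) x y)"

definition mesh_category ::
    "('k, 'r) ring_scheme \<Rightarrow> ('a, 'b) translation_quiver
      \<Rightarrow> ('a, 'k, ('b list \<Rightarrow> 'k) set) linear_cat" where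
  "mesh_category R \<Gamma> = quotient_cat (path_category R (quiver \<Gamma>)) (mesh_ideal R \<Gamma>)"

definition mesh_arrow ::
    "('k, 'r) ring_scheme \<Rightarrow> ('a, 'b) translation_quiver \<Rightarrow> 'b \<Rightarrow> ('b list \<Rightarrow> 'k) set" where
  "mesh_arrow R \<Gamma> b =
     (let x = tail (quiver \<Gamma>) b; y = head (quiver \<Gamma>) b
      in mesh_ideal R \<Gamma> x y +>\<^bsub>Hom (path_category R (quiver \<Gamma>)) x y\<^esub> basis_elem R [b])"

definition arrow_map ::
    "('k, 'r) ring_scheme \<Rightarrow> ('a, 'b) translation_quiver
      \<Rightarrow> ('a, ('b list \<Rightarrow> 'k) set, 'k, 'v) module_functor \<Rightarrow> 'b \<Rightarrow> 'v \<Rightarrow> 'v" where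
  "arrow_map R \<Gamma> X b = FMor X (tail (quiver \<Gamma>) b) (head (quiver \<Gamma>) b) (mesh_arrow R \<Gamma> b)"

definition mesh_homology ::
    "('k, 'r) ring_scheme \<Rightarrow> ('a, 'b) translation_quiver
      \<Rightarrow> ('a, ('b list \<Rightarrow> 'k) set, 'k, 'v) module_functor \<Rightarrow> 'a \<Rightarrow> ('k, ('b \<Rightarrow> 'v) set) module" where
  "mesh_homology R \<Gamma> X y =
     (let B = in_arcs (quiver \<Gamma>) y in
      homology
        (FOb X (translation \<Gamma> y))
        (direct_sum B (\<lambda>b. FOb X (tail (quiver \<Gamma>) b)))
        (FOb X y)
        (\<lambda>v. \<lambda>b\<in>B. arrow_map R \<Gamma> X (semitranslation \<Gamma> b) v)
        (\<lambda>w. \<Oplus>\<^bsub>FOb X y\<^esub> b\<in>B. arrow_map R \<Gamma> X b (w b)))"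

definition normal_quiver :: "('k, 'r) ring_scheme \<Rightarrow> ('a, 'b) translation_quiver \<Rightarrow> bool" where
  "normal_quiver R \<Gamma> \<longleftrightarrow>
     (\<forall>x\<in>verts (quiver \<Gamma>). \<forall>y\<in>verts (quiver \<Gamma>).
        let H = mesh_homology R \<Gamma> (representable (mesh_category R \<Gamma>) x) y
        in carrier H = {\<zero>\<^bsub>H\<^esub>})"


section \<open>The repetitive quiver\<close>

definition linear_quiver :: "nat \<Rightarrow> (nat, nat) pre_digraph" where
  "linear_quiver n = \<lparr>verts = {1..n}, arcs = {1..<n}, tail = (\<lambda>q. q), head = (\<lambda>q. q + 1)\<rparr>"

text \<open>\<open>Arr a i\<close> and \<open>Star a i\<close> are the arrows \<open>a\<^sub>i\<close> and \<open>a\<^sup>*\<^sub>i\<close> of the repetitive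
  quiver.\<close>

datatype 'b rep_arrow = Arr 'b int | Star 'b int

definition repetitive_quiver ::
    "('a, 'b) pre_digraph \<Rightarrow> ('a \<times> int, 'b rep_arrow) translation_quiver" where
  "repetitive_quiver G = \<lparr>
     quiver = \<lparr>
       verts = verts G \<times> UNIV,
       arcs = (\<Union>a\<in>arcs G. \<Union>i. {Arr a i, Star a i}),
       tail = (\<lambda>b. case b of Arr a i \<Rightarrow> (tail G a, i) | Star a i \<Rightarrow> (head G a, i)),
       head = (\<lambda>b. case b of Arr a i \<Rightarrow> (head G a, i) | Star a i \<Rightarrow> (tail G a, i - 1))\<rparr>,
     translation = (\<lambda>(q, i). (q, i + 1)),
     semitranslation = (\<lambda>b. case b of Arr a i \<Rightarrow> Star a (i + 1) | Star a i \<Rightarrow> Arr a i)\<rparr>"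

lemma in_arcs_repetitive_linear:
  "in_arcs (quiver (repetitive_quiver (linear_quiver n))) (q, i) =
     (if 1 < q \<and> q \<le> n then {Arr (q - 1) i} else {}) \<union>
     (if 1 \<le> q \<and> q < n then {Star q (i + 1)} else {})"
  by (auto simp: in_arcs_def repetitive_quiver_def linear_quiver_def)

lemma out_arcs_repetitive_linear:
  "out_arcs (quiver (repetitive_quiver (linear_quiver n))) (q, i) =
     (if 1 \<le> q \<and> q < n then {Arr q i} else {}) \<union>
     (if 1 < q \<and> q \<le> n then {Star (q - 1) i} else {})"
  by (auto simp: out_arcs_def repetitive_quiver_def linear_quiver_def)

lemma stable_translation_quiver_repetitive_linear:
  "stable_translation_quiver (repetitive_quiver (linear_quiver n))" (is "stable_translation_quiver ?\<Gamma>")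
proof
  fix y assume "y \<in> verts (quiver ?\<Gamma>)"
  show "finite (in_arcs (quiver ?\<Gamma>) y)" "finite (out_arcs (quiver ?\<Gamma>) y)"
    by (cases y; simp add: in_arcs_repetitive_linear out_arcs_repetitive_linear)+
next
  show "bij_betw (translation ?\<Gamma>) (verts (quiver ?\<Gamma>)) (verts (quiver ?\<Gamma>))"
    by (rule bij_betw_byWitness[where f' = "\<lambda>(q, i). (q, i - 1)"])
      (auto simp: repetitive_quiver_def)
  show "bij_betw (semitranslation ?\<Gamma>) (arcs (quiver ?\<Gamma>)) (arcs (quiver ?\<Gamma>))"
    by (rule bij_betw_byWitness[where
          f' = "\<lambda>b. case b of Arr a i \<Rightarrow> Star a i | Star a i \<Rightarrow> Arr a (i - 1)"])
      (auto simp: repetitive_quiver_def)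
qed (auto simp: repetitive_quiver_def linear_quiver_def split: rep_arrow.splits)

lemma abelian_group_free_module:
  assumes "cring R"
  shows "abelian_group (free_module R S)"
proof -
  interpret R: cring R by fact
  have fin: "finite {s. f s \<oplus>\<^bsub>R\<^esub> g s \<noteq> \<zero>\<^bsub>R\<^esub>}"
    if "finite {s. f s \<noteq> \<zero>\<^bsub>R\<^esub>}" "finite {s. g s \<noteq> \<zero>\<^bsub>R\<^esub>}" for f g :: "'c \<Rightarrow> 'a"
    by (rule finite_subset[of _ "{s. f s \<noteq> \<zero>\<^bsub>R\<^esub>} \<union> {s. g s \<noteq> \<zero>\<^bsub>R\<^esub>}"]) (use that in auto)
  show ?thesis
  proof (rule abelian_groupI)
    fix f g assume "f \<in> carrier (free_module R S)" "g \<in> carrier (free_module R S)"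
    then show "f \<oplus>\<^bsub>free_module R S\<^esub> g \<in> carrier (free_module R S)"
      using fin[of f g] by (force simp: free_module_def image_subset_iff)
  next
    fix f assume f: "f \<in> carrier (free_module R S)"
    have "(\<lambda>s. \<ominus>\<^bsub>R\<^esub> f s) \<in> carrier (free_module R S)"
      using f by (auto simp: free_module_def image_subset_iff subset_iff elim!: finite_subset[rotated])
    moreover have "(\<lambda>s. \<ominus>\<^bsub>R\<^esub> f s) \<oplus>\<^bsub>free_module R S\<^esub> f = \<zero>\<^bsub>free_module R S\<^esub>"
      using f by (auto simp: free_module_def image_subset_iff R.l_neg)
    ultimately show "\<exists>g\<in>carrier (free_module R S).
        g \<oplus>\<^bsub>free_module R S\<^esub> f = \<zero>\<^bsub>free_module R S\<^esub>" by blast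
  qed (auto simp: free_module_def image_subset_iff fin R.a_ac)
qed

lemma mesh_relation_repetitive_linear:
  assumes "cring R" "n \<ge> 2" "1 \<le> q" "q \<le> n"
  defines "\<Gamma> \<equiv> repetitive_quiver (linear_quiver n)"
  shows "mesh_relation R \<Gamma> (q, i) =
    (if q = 1 then basis_elem R [Arr 1 (i + 1), Star 1 (i + 1)]
     else if q = n then basis_elem R [Star (n - 1) (i + 1), Arr (n - 1) i]
     else basis_elem R [Star (q - 1) (i + 1), Arr (q - 1) i]
       \<oplus>\<^bsub>Hom (path_category R (quiver \<Gamma>)) (q, i + 1) (q, i)\<^esub>
       basis_elem R [Arr q (i + 1), Star q (i + 1)])"
proof -
  interpret R: cring R by fact
  let ?W = "{p. pre_digraph.awalk (quiver \<Gamma>) (q, i + 1) p (q, i)}"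
  interpret M: abelian_group "free_module R ?W"
    by (rule abelian_group_free_module) fact
  have supp: "{t. (if t = s then \<one>\<^bsub>R\<^esub> else \<zero>\<^bsub>R\<^esub>) \<noteq> \<zero>\<^bsub>R\<^esub>} \<subseteq> {s}" for s :: "nat rep_arrow list"
    by auto
  have basis: "basis_elem R s \<in> carrier (free_module R ?W)" if "s \<in> ?W" for s
    using supp[of s] that
    by (auto simp: basis_elem_def free_module_def image_subset_iff intro: finite_subset)
  have walk1: "[Star (q - 1) (i + 1), Arr (q - 1) i] \<in> ?W" if "1 < q"
    using that assms by (auto simp: pre_digraph.awalk_def pre_digraph.cas.simps
        repetitive_quiver_def linear_quiver_def)
  have walk2: "[Arr q (i + 1), Star q (i + 1)] \<in> ?W" if "q < n"
    using that assms by (auto simp: pre_digraph.awalk_def pre_digraph.cas.simps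
        repetitive_quiver_def linear_quiver_def)
  have hom: "Hom (path_category R (quiver \<Gamma>)) (q, i + 1) (q, i) = free_module R ?W"
    by (simp add: path_category_def)
  have tr: "translation \<Gamma> (q, i) = (q, i + 1)"
    and sem: "semitranslation \<Gamma> (Arr a j) = Star a (j + 1)"
      "semitranslation \<Gamma> (Star a j) = Arr a j" for a j
    by (simp_all add: \<Gamma>_def repetitive_quiver_def)
  have arcs: "in_arcs (quiver \<Gamma>) (q, i) =
     (if 1 < q \<and> q \<le> n then {Arr (q - 1) i} else {}) \<union>
     (if 1 \<le> q \<and> q < n then {Star q (i + 1)} else {})"
    unfolding \<Gamma>_def by (rule in_arcs_repetitive_linear)
  have single: "finsum (free_module R ?W) f {b} = f b"
    if "f b \<in> carrier (free_module R ?W)" for f and b :: "nat rep_arrow"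
    using that M.finsum_insert[of "{}" b f] M.r_zero by simp
  have pair: "finsum (free_module R ?W) f {c, b} = f b \<oplus>\<^bsub>free_module R ?W\<^esub> f c"
    if "f b \<in> carrier (free_module R ?W)" "f c \<in> carrier (free_module R ?W)" "b \<noteq> c"
    for f and b c :: "nat rep_arrow"
    using that M.finsum_insert[of "{b}" c f] single[of f b] M.a_comm by simp
  consider "q = 1" "q < n" | "q = n" "1 < q" | "1 < q" "q < n"
    using assms by linarith
  then show ?thesis
  proof cases
    case 1
    then show ?thesis
      unfolding mesh_relation_def tr hom arcs
      using single[of "\<lambda>b. basis_elem R [semitranslation \<Gamma> b, b]" "Star q (i + 1)"] basis[OF walk2]
      by (simp add: sem del: mem_Collect_eq)
  next
    case 2
    then show ?thesis
      unfolding mesh_relation_def tr hom arcs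
      using single[of "\<lambda>b. basis_elem R [semitranslation \<Gamma> b, b]" "Arr (q - 1) i"] basis[OF walk1]
      by (simp add: sem del: mem_Collect_eq)
  next
    case 3
    then show ?thesis
      unfolding mesh_relation_def tr hom arcs
      using basis[OF walk1] basis[OF walk2]
      by (simp add: pair sem M.a_comm del: mem_Collect_eq)
  qed
qed

end

theory Submission
  imports Defs
begin

text \<open>
  Give the arrow \<open>Star q i\<close> the sign \<open>(-1)\<^sup>q\<close> and \<open>Arr q i\<close> the sign \<open>1\<close>. Then the two paths of
  an inner mesh have opposite signs, so modulo the mesh relations any two paths from \<open>x\<close> to \<open>y\<close>
  agree up to their signs: paths that end in different arrows are both compared with paths that run
  through the mesh at \<open>y\<close>. All paths from \<open>x = (p, j)\<close> to \<open>y\<close> use the same number \<open>a\<close> of arrows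
  \<open>Arr\<close> and the same number \<open>s\<close> of arrows \<open>Star\<close>. If \<open>a > n - p\<close> or \<open>s \<ge> p\<close>, then one of the
  paths contains a boundary mesh and all of them vanish; otherwise the signed sum of the
  coefficients kills the mesh ideal. Hence \<open>Q(x, y)\<close> is free of rank one on the rectangle
  \<open>0 \<le> a \<le> n - p\<close>, \<open>0 \<le> s < p\<close>, and zero outside of it, and between vertices of the rectangle
  the arrows act by their signs. Exactness of the mesh complex is then a matter of which of the
  vertices of the mesh lie in the rectangle.
\<close>

section \<open>Free modules and path categories\<close>

context cring
begin

lemma free_module_simps [simp]:
  "\<zero>\<^bsub>free_module R S\<^esub> = (\<lambda>s. \<zero>)"
  "f \<oplus>\<^bsub>free_module R S\<^esub> g = (\<lambda>s. f s \<oplus> g s)"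
  "r \<odot>\<^bsub>free_module R S\<^esub> f = (\<lambda>s. r \<otimes> f s)"
  by (simp_all add: free_module_def)

lemma free_module_closed [simp]:
  "f \<in> carrier (free_module R S) \<Longrightarrow> f s \<in> carrier R"
  by (auto simp: free_module_def)

lemma free_module_outside:
  "f \<in> carrier (free_module R S) \<Longrightarrow> s \<notin> S \<Longrightarrow> f s = \<zero>"
  by (auto simp: free_module_def)

lemma free_module_zero_closed [simp]: "(\<lambda>s. \<zero>) \<in> carrier (free_module R S)"
  by (auto simp: free_module_def)

lemma free_module_add_closed [simp]:
  assumes "f \<in> carrier (free_module R S)" "g \<in> carrier (free_module R S)"
  shows "(\<lambda>s. f s \<oplus> g s) \<in> carrier (free_module R S)"
proof -
  interpret M: abelian_group "free_module R S"
    by (rule abelian_group_free_module[OF is_cring])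
  show ?thesis using M.a_closed[OF assms] by simp
qed

lemma free_module_smult_closed [simp]:
  assumes "r \<in> carrier R" "f \<in> carrier (free_module R S)"
  shows "(\<lambda>s. r \<otimes> f s) \<in> carrier (free_module R S)"
proof -
  have sub: "{s. r \<otimes> f s \<noteq> \<zero>} \<subseteq> {s. f s \<noteq> \<zero>}" using assms(1) by auto
  then have "finite {s. r \<otimes> f s \<noteq> \<zero>}"
    by (rule finite_subset) (use assms(2) in \<open>simp add: free_module_def\<close>)
  with assms sub show ?thesis
    by (auto simp: free_module_def)
qed

lemma basis_elem_closed [simp]:
  assumes "s \<in> S"
  shows "basis_elem R s \<in> carrier (free_module R S)"
proof -
  have sub: "{t. basis_elem R s t \<noteq> \<zero>} \<subseteq> {s}" by (auto simp: basis_elem_def)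
  then have "finite {t. basis_elem R s t \<noteq> \<zero>}" by (rule finite_subset) simp
  with assms sub show ?thesis
    by (auto simp: free_module_def basis_elem_def)
qed

lemma basis_elem_apply_closed [simp]: "basis_elem R s t \<in> carrier R"
  by (simp add: basis_elem_def)

text \<open>Reduces every linear statement about a hom module to single paths. The support shrinks
  by one point per step: \<open>?g\<close> erases the value of \<open>f\<close> at
  \<open>s\<close>.\<close>

lemma free_module_induct [consumes 1, case_names zero add]:
  assumes f: "f \<in> carrier (free_module R S)"
    and zero: "P (\<lambda>s. \<zero>)"
    and add: "\<And>f r s. f \<in> carrier (free_module R S) \<Longrightarrow> r \<in> carrier R \<Longrightarrow> s \<in> S \<Longrightarrow> P f
      \<Longrightarrow> P (\<lambda>t. f t \<oplus> r \<otimes> basis_elem R s t)"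
  shows "P f"
proof -
  have "finite {s. f s \<noteq> \<zero>}" using f by (simp add: free_module_def)
  then show ?thesis using f
  proof (induction "{s. f s \<noteq> \<zero>}" arbitrary: f rule: finite_induct)
    case empty
    then have "f = (\<lambda>s. \<zero>)" by auto
    then show ?case using zero by simp
  next
    case (insert s T)
    let ?g = "\<lambda>t. if t = s then \<zero> else f t"
    have T: "T = {t. ?g t \<noteq> \<zero>}" using insert.hyps by auto
    have g: "?g \<in> carrier (free_module R S)"
    proof -
      have "finite {t. ?g t \<noteq> \<zero>}" using insert.hyps(1) unfolding T .
      then show ?thesis using insert.prems by (auto simp: free_module_def)
    qed
    have s: "s \<in> S" using insert.hyps(4) free_module_outside[OF insert.prems, of s] by blast
    have "f = (\<lambda>t. ?g t \<oplus> f s \<otimes> basis_elem R s t)"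
      using insert.prems by (auto simp: basis_elem_def)
    moreover have "P \<dots>"
      using insert.hyps(3)[OF T g] g s insert.prems by (intro add) auto
    ultimately show ?case by simp
  qed
qed

section \<open>Convolution in the path category\<close>

lemma path_category_simps [simp]:
  "Ob (path_category R G) = verts G"
  "Hom (path_category R G) x y = free_module R {p. pre_digraph.awalk G x p y}"
  by (simp_all add: path_category_def)

text \<open>Convolution does not inspect the endpoints, so only the values have to lie in the ring;
  single paths can then be inserted with no condition on walks.\<close>

lemma Comp_add_left:
  assumes "range f \<subseteq> carrier R" "range g \<subseteq> carrier R" "range g' \<subseteq> carrier R"
  shows "Comp (path_category R G) x y z (\<lambda>p. g p \<oplus> g' p) f =
    (\<lambda>r. Comp (path_category R G) x y z g f r \<oplus> Comp (path_category R G) x y z g' f r)"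
proof
  fix r
  have [simp]: "f p \<in> carrier R" "g p \<in> carrier R" "g' p \<in> carrier R" for p
    using assms by auto
  show "Comp (path_category R G) x y z (\<lambda>p. g p \<oplus> g' p) f r =
    Comp (path_category R G) x y z g f r \<oplus> Comp (path_category R G) x y z g' f r"
    by (simp add: path_category_def l_distr finsum_addf)
qed

lemma Comp_add_right:
  assumes "range f \<subseteq> carrier R" "range g \<subseteq> carrier R" "range f' \<subseteq> carrier R"
  shows "Comp (path_category R G) x y z g (\<lambda>p. f p \<oplus> f' p) =
    (\<lambda>r. Comp (path_category R G) x y z g f r \<oplus> Comp (path_category R G) x y z g f' r)"
proof
  fix r
  have [simp]: "f p \<in> carrier R" "g p \<in> carrier R" "f' p \<in> carrier R" for p
    using assms by auto
  show "Comp (path_category R G) x y z g (\<lambda>p. f p \<oplus> f' p) r =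
    Comp (path_category R G) x y z g f r \<oplus> Comp (path_category R G) x y z g f' r"
    by (simp add: path_category_def r_distr finsum_addf)
qed

lemma Comp_smult_left:
  assumes "range f \<subseteq> carrier R" "range g \<subseteq> carrier R" "c \<in> carrier R"
  shows "Comp (path_category R G) x y z (\<lambda>p. c \<otimes> g p) f =
    (\<lambda>r. c \<otimes> Comp (path_category R G) x y z g f r)"
proof
  fix r
  have [simp]: "f p \<in> carrier R" "g p \<in> carrier R" for p
    using assms by auto
  show "Comp (path_category R G) x y z (\<lambda>p. c \<otimes> g p) f r =
    c \<otimes> Comp (path_category R G) x y z g f r"
    using assms(3) by (simp add: path_category_def m_assoc finsum_rdistr)
qed

lemma Comp_smult_right:
  assumes "range f \<subseteq> carrier R" "range g \<subseteq> carrier R" "c \<in> carrier R"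
  shows "Comp (path_category R G) x y z g (\<lambda>p. c \<otimes> f p) =
    (\<lambda>r. c \<otimes> Comp (path_category R G) x y z g f r)"
proof
  fix r
  have [simp]: "f p \<in> carrier R" "g p \<in> carrier R" for p
    using assms by auto
  show "Comp (path_category R G) x y z g (\<lambda>p. c \<otimes> f p) r =
    c \<otimes> Comp (path_category R G) x y z g f r"
    using assms(3) by (simp add: path_category_def m_lcomm finsum_rdistr)
qed

lemma Comp_zero_left:
  assumes "range f \<subseteq> carrier R"
  shows "Comp (path_category R G) x y z (\<lambda>p. \<zero>) f = (\<lambda>r. \<zero>)"
  using assms by (auto simp: path_category_def fun_eq_iff finsum_zero image_subset_iff)

lemma Comp_zero_right:
  assumes "range g \<subseteq> carrier R"
  shows "Comp (path_category R G) x y z g (\<lambda>p. \<zero>) = (\<lambda>r. \<zero>)"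
  using assms by (auto simp: path_category_def fun_eq_iff finsum_zero image_subset_iff)

text \<open>A cut of \<open>r\<close> into \<open>p\<close> and \<open>q\<close> can occur at
  position \<open>length p\<close> only, so at most one summand survives.\<close>

lemma Comp_basis:
  "Comp (path_category R G) x y z (basis_elem R q) (basis_elem R p) = basis_elem R (p @ q)"
proof
  fix r
  have eq: "basis_elem R q (drop k r) \<otimes> basis_elem R p (take k r) =
      (if length p = k then basis_elem R (p @ q) r else \<zero>)" if "k \<le> length r" for k
  proof (cases "take k r = p \<and> drop k r = q")
    case True
    then have "r = p @ q" using append_take_drop_id[of k r] by simp
    moreover have "length p = k" using True that by (metis length_take min.absorb2)
    ultimately show ?thesis by (simp add: basis_elem_def)
  next
    case False
    moreover from this have "\<not> (length p = k \<and> r = p @ q)" by force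
    ultimately show ?thesis by (simp add: basis_elem_def)
  qed
  have "Comp (path_category R G) x y z (basis_elem R q) (basis_elem R p) r =
     (\<Oplus>k\<in>{..length r}. if length p = k then basis_elem R (p @ q) r else \<zero>)"
    unfolding path_category_def linear_cat.simps by (rule finsum_cong') (auto simp: eq)
  also have "\<dots> = basis_elem R (p @ q) r"
  proof (cases "length p \<le> length r")
    case True
    then show ?thesis
      using finsum_singleton[of "length p" "{..length r}" "\<lambda>k. basis_elem R (p @ q) r"] by simp
  next
    case False
    then have "basis_elem R (p @ q) r = \<zero>" by (auto simp: basis_elem_def)
    then show ?thesis using add.finprod_one_eqI[of "{..length r}"] by simp
  qed
  finally show "Comp (path_category R G) x y z (basis_elem R q) (basis_elem R p) r
    = basis_elem R (p @ q) r" .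
qed

end


section \<open>Walks in the repetitive quiver\<close>

abbreviation (input) rep_linear :: "nat \<Rightarrow> (nat \<times> int, nat rep_arrow) translation_quiver" where
  "rep_linear n \<equiv> repetitive_quiver (linear_quiver n)"

lemma rep_linear_simps [simp]:
  "verts (quiver (rep_linear n)) = {1..n} \<times> UNIV"
  "Arr q i \<in> arcs (quiver (rep_linear n)) \<longleftrightarrow> 1 \<le> q \<and> q < n"
  "Star q i \<in> arcs (quiver (rep_linear n)) \<longleftrightarrow> 1 \<le> q \<and> q < n"
  "tail (quiver (rep_linear n)) (Arr q i) = (q, i)"
  "tail (quiver (rep_linear n)) (Star q i) = (q + 1, i)"
  "head (quiver (rep_linear n)) (Arr q i) = (q + 1, i)"
  "head (quiver (rep_linear n)) (Star q i) = (q, i - 1)"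
  "translation (rep_linear n) (q, i) = (q, i + 1)"
  "semitranslation (rep_linear n) (Arr q i) = Star q (i + 1)"
  "semitranslation (rep_linear n) (Star q i) = Arr q i"
  by (auto simp: repetitive_quiver_def linear_quiver_def)

text \<open>The numbers of arrows of the two kinds on any path from \<open>x\<close> to \<open>y\<close>.\<close>

definition arrs :: "nat \<times> int \<Rightarrow> nat \<times> int \<Rightarrow> int" where
  "arrs x y = int (fst y) - int (fst x) + snd x - snd y"

definition stars :: "nat \<times> int \<Rightarrow> nat \<times> int \<Rightarrow> int" where
  "stars x y = snd x - snd y"

text \<open>The hom module of the mesh category from \<open>x\<close> to \<open>y\<close> is free of rank one
  if \<open>hammock n x y\<close> holds and vanishes otherwise.\<close>

definition hammock :: "nat \<Rightarrow> nat \<times> int \<Rightarrow> nat \<times> int \<Rightarrow> bool" where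
  "hammock n x y \<longleftrightarrow> 0 \<le> arrs x y \<and> arrs x y \<le> int n - int (fst x)
     \<and> 0 \<le> stars x y \<and> stars x y < int (fst x)"

abbreviation walks :: "nat \<Rightarrow> nat \<times> int \<Rightarrow> nat \<times> int \<Rightarrow> nat rep_arrow list set" where
  "walks n x y \<equiv> {p. pre_digraph.awalk (quiver (rep_linear n)) x p y}"

lemma wf_digraph_rep_linear: "wf_digraph (quiver (rep_linear n))"
  using stable_translation_quiver_repetitive_linear by (rule stable_translation_quiver.wf_digraph)

lemma awalk_Cons:
  "pre_digraph.awalk (quiver (rep_linear n)) x (b # p) y \<longleftrightarrow>
     b \<in> arcs (quiver (rep_linear n)) \<and> x = tail (quiver (rep_linear n)) b \<and>
     pre_digraph.awalk (quiver (rep_linear n)) (head (quiver (rep_linear n)) b) p y"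
  by (rule wf_digraph.awalk_Cons_iff[OF wf_digraph_rep_linear])

lemma awalk_Nil:
  "pre_digraph.awalk (quiver (rep_linear n)) x [] y \<longleftrightarrow> x = y \<and> fst x \<in> {1..n}"
  by (cases x) (auto simp: wf_digraph.awalk_Nil_iff[OF wf_digraph_rep_linear])

lemma awalk_append:
  "pre_digraph.awalk (quiver (rep_linear n)) x (p @ q) z \<longleftrightarrow>
     (\<exists>y. pre_digraph.awalk (quiver (rep_linear n)) x p y
        \<and> pre_digraph.awalk (quiver (rep_linear n)) y q z)"
proof (induction p arbitrary: x)
  case Nil
  interpret wf_digraph "quiver (rep_linear n)" by (rule wf_digraph_rep_linear)
  have "fst x \<in> {1..n}" if "awalk x q z"
    using awalk_hd_in_verts[OF that] by (cases x) simp
  then show ?case by (auto simp: awalk_Nil)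
qed (simp add: awalk_Cons)

section \<open>Counting, finiteness and existence of walks\<close>

lemma awalk_verts:
  assumes "pre_digraph.awalk (quiver (rep_linear n)) x p y"
  shows "fst x \<in> {1..n}" "fst y \<in> {1..n}"
proof -
  interpret wf_digraph "quiver (rep_linear n)" by (rule wf_digraph_rep_linear)
  show "fst x \<in> {1..n}" "fst y \<in> {1..n}"
    using awalk_hd_in_verts[OF assms] awalk_last_in_verts[OF assms] by (cases x; cases y; simp)+
qed

text \<open>An \<open>Arr\<close> raises the level by one; a \<open>Star\<close> lowers both the
  level and the integer coordinate by one. So the endpoints determine both counts, and walks with
  common endpoints have equal length.\<close>

lemma awalk_length:
  assumes "pre_digraph.awalk (quiver (rep_linear n)) x p y"
  shows "0 \<le> arrs x y \<and> 0 \<le> stars x y \<and> int (length p) = arrs x y + stars x y"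
  using assms
proof (induction p arbitrary: x)
  case Nil
  then show ?case by (auto simp: awalk_Nil arrs_def stars_def)
next
  case (Cons b p)
  have b: "b \<in> arcs (quiver (rep_linear n))" "x = tail (quiver (rep_linear n)) b"
    and p: "pre_digraph.awalk (quiver (rep_linear n)) (head (quiver (rep_linear n)) b) p y"
    using Cons.prems by (auto simp: awalk_Cons)
  show ?case using Cons.IH[OF p] b
    by (cases b) (auto simp: arrs_def stars_def)
qed

lemma finite_walks: "finite (walks n x y)"
proof -
  let ?G = "quiver (rep_linear n)"
  have fin: "finite {p. length p = k \<and> (\<exists>y. pre_digraph.awalk ?G x p y)}" for k x
  proof (induction k arbitrary: x)
    case 0
    have "{p. length p = 0 \<and> (\<exists>y. pre_digraph.awalk ?G x p y)} \<subseteq> {[]}" by auto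
    then show ?case by (rule finite_subset) simp
  next
    case (Suc k)
    have "finite (out_arcs ?G x)"
      by (cases x) (simp add: out_arcs_repetitive_linear)
    then have "finite (\<Union>b\<in>out_arcs ?G x. Cons b `
        {p. length p = k \<and> (\<exists>y. pre_digraph.awalk ?G (head ?G b) p y)})"
      using Suc.IH by simp
    moreover have "{p. length p = Suc k \<and> (\<exists>y. pre_digraph.awalk ?G x p y)} \<subseteq>
      (\<Union>b\<in>out_arcs ?G x. Cons b ` {p. length p = k \<and> (\<exists>y. pre_digraph.awalk ?G (head ?G b) p y)})"
    proof
      fix p assume "p \<in> {p. length p = Suc k \<and> (\<exists>y. pre_digraph.awalk ?G x p y)}"
      then obtain b p' y where "p = b # p'" "length p' = k" "pre_digraph.awalk ?G x (b # p') y"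
        by (auto simp: length_Suc_conv)
      then show "p \<in> (\<Union>b\<in>out_arcs ?G x. Cons b `
          {p. length p = k \<and> (\<exists>y. pre_digraph.awalk ?G (head ?G b) p y)})"
        unfolding awalk_Cons out_arcs_def by blast
    qed
    ultimately show ?case by (rule finite_subset[rotated])
  qed
  have "walks n x y \<subseteq> {p. length p = nat (arrs x y + stars x y) \<and> (\<exists>y. pre_digraph.awalk ?G x p y)}"
    using awalk_length by fastforce
  then show ?thesis using fin by (rule finite_subset)
qed

text \<open>The walk is built backwards from \<open>y\<close>: its last arrow is an
  \<open>Arr\<close> where possible and a \<open>Star\<close> otherwise.\<close>

lemma awalk_exists:
  assumes "n \<ge> 2" "fst x \<in> {1..n}" "fst y \<in> {1..n}" "0 \<le> arrs x y" "0 \<le> stars x y"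
  shows "\<exists>p. pre_digraph.awalk (quiver (rep_linear n)) x p y"
  using assms(3-5)
proof (induction "nat (arrs x y + stars x y)" arbitrary: y)
  case 0
  then have "x = y" by (cases x; cases y) (auto simp: arrs_def stars_def)
  then show ?case using assms(2) awalk_Nil by blast
next
  case (Suc k)
  obtain p j where x: "x = (p, j)" by (cases x)
  obtain q i where y: "y = (q, i)" by (cases y)
  have q: "1 \<le> q" "q \<le> n" using Suc.prems y by auto
  show ?case
  proof (cases "q > 1 \<and> arrs x y \<ge> 1")
    case True
    have "\<exists>w. pre_digraph.awalk (quiver (rep_linear n)) x w (q - 1, i)"
      using Suc.prems Suc.hyps(2) True q
      by (intro Suc.hyps(1)) (auto simp: x y arrs_def stars_def)
    moreover have "pre_digraph.awalk (quiver (rep_linear n)) (q - 1, i) [Arr (q - 1) i] y"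
      using True q by (auto simp: awalk_Cons awalk_Nil y)
    ultimately show ?thesis by (meson awalk_append)
  next
    case False
    \<comment> \<open>If \<open>arrs x y = 0\<close>, the positive total is \<open>stars x y\<close>
      and \<open>q\<close> lies below \<open>p\<close>; if \<open>q = 1\<close> and
      \<open>arrs x y\<close> is positive, then \<open>stars x y\<close> is at least
      \<open>p\<close>.\<close>
    have *: "q < n" "stars x y \<ge> 1"
      using False Suc.prems Suc.hyps(2) assms(1,2) by (auto simp: x y arrs_def stars_def)
    have "\<exists>w. pre_digraph.awalk (quiver (rep_linear n)) x w (q + 1, i + 1)"
      using Suc.prems Suc.hyps(2) * q
      by (intro Suc.hyps(1)) (auto simp: x y arrs_def stars_def)
    moreover have "pre_digraph.awalk (quiver (rep_linear n)) (q + 1, i + 1) [Star q (i + 1)] y"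
      using * q by (auto simp: awalk_Cons awalk_Nil y)
    ultimately show ?thesis by (meson awalk_append)
  qed
qed

text \<open>Both counts add up along a composite and are nonnegative on walks, so the bounds pass to
  the factors. The converse fails: each arrow of a boundary mesh satisfies the bounds, but the
  composite of the two does not.\<close>

lemma hammock_compose:
  assumes "hammock n x z" "p \<in> walks n x y" "q \<in> walks n y z"
  shows "hammock n x y" "hammock n y z"
  using assms awalk_length[of n x p y] awalk_length[of n y q z]
  by (auto simp: hammock_def arrs_def stars_def)

lemma hammock_walk:
  assumes "n \<ge> 2" "fst x \<in> {1..n}" "hammock n x y"
  obtains p where "p \<in> walks n x y"
proof -
  have "fst y \<in> {1..n}" using assms by (auto simp: hammock_def arrs_def stars_def)
  then show ?thesis using awalk_exists[of n x y] assms that by (auto simp: hammock_def)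
qed


section \<open>The evaluation functionals\<close>

locale repetitive_linear = cring R for R (structure) +
  fixes n :: nat
  assumes two_le_n: "n \<ge> 2"
begin

abbreviation "\<Gamma> \<equiv> rep_linear n"
abbreviation "PC \<equiv> path_category R (quiver \<Gamma>)"
abbreviation "paths x y \<equiv> free_module R (walks n x y)"
abbreviation "I \<equiv> mesh_ideal R \<Gamma>"

definition arrow_weight :: "nat rep_arrow \<Rightarrow> 'a" where
  "arrow_weight b = (case b of Arr q i \<Rightarrow> \<one> | Star q i \<Rightarrow> if even q then \<one> else \<ominus> \<one>)"

primrec weight :: "nat rep_arrow list \<Rightarrow> 'a" where
  "weight [] = \<one>"
| "weight (b # p) = arrow_weight b \<otimes> weight p"

text \<open>The value is zero outside the hammock because the hom module of the mesh category
  vanishes there; this makes the mesh ideal the kernel of \<open>ev\<close> for all pairs of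
  vertices.\<close>

definition ev :: "nat \<times> int \<Rightarrow> nat \<times> int \<Rightarrow> (nat rep_arrow list \<Rightarrow> 'a) \<Rightarrow> 'a" where
  "ev x y f = (if hammock n x y then \<Oplus>p\<in>walks n x y. weight p \<otimes> f p else \<zero>)"

lemma arrow_weight_closed [simp]: "arrow_weight b \<in> carrier R"
  by (simp add: arrow_weight_def split: rep_arrow.splits)

lemma arrow_weight_square [simp]: "arrow_weight b \<otimes> arrow_weight b = \<one>"
  by (simp add: arrow_weight_def l_minus r_minus split: rep_arrow.splits)

lemma weight_closed [simp]: "weight p \<in> carrier R"
  by (induction p) auto

lemma weight_append: "weight (p @ q) = weight p \<otimes> weight q"
  by (induction p) (auto simp: m_assoc)

lemma weight_square [simp]: "weight p \<otimes> weight p = \<one>"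
proof (induction p)
  case (Cons b p)
  have "weight (b # p) \<otimes> weight (b # p) =
      (arrow_weight b \<otimes> arrow_weight b) \<otimes> (weight p \<otimes> weight p)"
    unfolding weight.simps by (simp only: m_ac arrow_weight_closed weight_closed m_closed)
  then show ?case using Cons by simp
qed simp

lemma weight_square_cancel: "c \<in> carrier R \<Longrightarrow> weight p \<otimes> (weight p \<otimes> c) = c"
  by (simp add: m_assoc[symmetric])

lemma paths_range: "f \<in> carrier (paths x y) \<Longrightarrow> range f \<subseteq> carrier R"
  by (auto simp: free_module_def)

lemma basis_range: "range (basis_elem R s) \<subseteq> carrier R"
  by auto

lemma ev_closed [simp]: "f \<in> carrier (paths x y) \<Longrightarrow> ev x y f \<in> carrier R"
  by (auto simp: ev_def intro!: finsum_closed)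

lemma ev_zero [simp]: "ev x y (\<lambda>p. \<zero>) = \<zero>"
  by (simp add: ev_def finsum_zero)

lemma ev_add [simp]:
  "f \<in> carrier (paths x y) \<Longrightarrow> g \<in> carrier (paths x y) \<Longrightarrow>
    ev x y (\<lambda>p. f p \<oplus> g p) = ev x y f \<oplus> ev x y g"
  by (simp add: ev_def r_distr finsum_addf Pi_def)

lemma ev_smult [simp]:
  assumes "f \<in> carrier (paths x y)" "c \<in> carrier R"
  shows "ev x y (\<lambda>p. c \<otimes> f p) = c \<otimes> ev x y f"
proof -
  have "(\<Oplus>p\<in>walks n x y. weight p \<otimes> (c \<otimes> f p)) = (\<Oplus>p\<in>walks n x y. c \<otimes> (weight p \<otimes> f p))"
    by (rule finsum_cong') (use assms in \<open>auto simp: m_lcomm\<close>)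
  also have "\<dots> = c \<otimes> (\<Oplus>p\<in>walks n x y. weight p \<otimes> f p)"
    by (rule finsum_rdistr[symmetric]) (use assms finite_walks in auto)
  finally show ?thesis using assms by (simp add: ev_def)
qed

lemma ev_basis:
  assumes "p \<in> walks n x y"
  shows "ev x y (basis_elem R p) = (if hammock n x y then weight p else \<zero>)"
proof -
  have "(\<Oplus>s\<in>walks n x y. weight s \<otimes> basis_elem R p s) =
      (\<Oplus>s\<in>walks n x y. if p = s then weight s else \<zero>)"
    by (rule finsum_cong') (auto simp: basis_elem_def)
  also have "\<dots> = weight p"
    by (rule finsum_singleton) (use assms finite_walks in auto)
  finally show ?thesis by (simp add: ev_def)
qed

text \<open>Both sides are bilinear, and \<open>weight\<close> is multiplicative on paths. The case
  distinction reflects that a composite may leave the hammock although its factors do not.\<close>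

lemma Comp_paths:
  assumes f: "f \<in> carrier (paths x y)" and g: "g \<in> carrier (paths y z)"
  shows "Comp PC x y z g f \<in> carrier (paths x z)"
    and "ev x z (Comp PC x y z g f) = (if hammock n x z then ev y z g \<otimes> ev x y f else \<zero>)"
proof -
  let ?P = "\<lambda>g f. Comp PC x y z g f \<in> carrier (paths x z) \<and>
    ev x z (Comp PC x y z g f) = (if hammock n x z then ev y z g \<otimes> ev x y f else \<zero>)"
  \<comment> \<open>Linear induction on \<open>g\<close> against a single path comes first;
    \<open>f\<close> is then extended in the same way.\<close>
  have basis: "?P g (basis_elem R p)" if p: "p \<in> walks n x y" for p
    using g
  proof (induction g rule: free_module_induct)
    case zero
    then show ?case by (simp add: Comp_zero_left basis_range ev_basis[OF p])
  next
    case (add g r q)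
    have pq: "p @ q \<in> walks n x z" using p add.hyps(3) awalk_append by blast
    have eq: "Comp PC x y z (\<lambda>t. g t \<oplus> r \<otimes> basis_elem R q t) (basis_elem R p) =
        (\<lambda>t. Comp PC x y z g (basis_elem R p) t \<oplus> r \<otimes> basis_elem R (p @ q) t)"
      using add.hyps by (subst Comp_add_left)
        (auto simp: Comp_smult_left Comp_basis basis_range intro: paths_range)
    have hm: "hammock n x y" "hammock n y z" if "hammock n x z"
      using hammock_compose[OF that p add.hyps(3)] by auto
    show ?case
      unfolding eq using add.hyps add.IH hm p pq
      by (auto simp: ev_basis weight_append l_distr r_distr m_ac)
  qed
  have "?P g f"
    using f
  proof (induction f rule: free_module_induct)
    case zero
    then show ?case using g by (simp add: Comp_zero_right paths_range)
  next
    case (add f r p)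
    have eq: "Comp PC x y z g (\<lambda>t. f t \<oplus> r \<otimes> basis_elem R p t) =
        (\<lambda>t. Comp PC x y z g f t \<oplus> r \<otimes> Comp PC x y z g (basis_elem R p) t)"
      using add.hyps paths_range[OF g] by (subst Comp_add_right)
        (auto simp: Comp_smult_right basis_range intro: paths_range)
    show ?case
      unfolding eq using add.hyps add.IH basis[OF add.hyps(3)] g
      by (auto simp: r_distr m_ac)
  qed
  then show "Comp PC x y z g f \<in> carrier (paths x z)"
    "ev x z (Comp PC x y z g f) = (if hammock n x z then ev y z g \<otimes> ev x y f else \<zero>)"
    by auto
qed

section \<open>The mesh ideal\<close>

lemma mesh_walks:
  "1 < q \<Longrightarrow> q \<le> n \<Longrightarrow> [Star (q - 1) (i + 1), Arr (q - 1) i] \<in> walks n (q, i + 1) (q, i)"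
  "1 \<le> q \<Longrightarrow> q < n \<Longrightarrow> [Arr q (i + 1), Star q (i + 1)] \<in> walks n (q, i + 1) (q, i)"
  by (auto simp: awalk_Cons awalk_Nil)

lemma mesh_relation_eq:
  assumes "1 \<le> q" "q \<le> n"
  shows "mesh_relation R \<Gamma> (q, i) =
    (if q = 1 then basis_elem R [Arr 1 (i + 1), Star 1 (i + 1)]
     else if q = n then basis_elem R [Star (n - 1) (i + 1), Arr (n - 1) i]
     else (\<lambda>t. basis_elem R [Star (q - 1) (i + 1), Arr (q - 1) i] t
       \<oplus> basis_elem R [Arr q (i + 1), Star q (i + 1)] t))"
  using mesh_relation_repetitive_linear[OF is_cring two_le_n assms] by simp

text \<open>The paths of an inner mesh contain \<open>Star (q - 1)\<close> and
  \<open>Star q\<close>, whose signs are opposite. For a boundary mesh, \<open>y\<close> lies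
  outside the hammock of its translate: the bounds allow no \<open>Arr\<close> from level
  \<open>n\<close> and no \<open>Star\<close> from level 1.\<close>

lemma ev_mesh_relation:
  assumes "fst y \<in> {1..n}"
  shows "mesh_relation R \<Gamma> y \<in> carrier (paths (translation \<Gamma> y) y)"
    and "ev (translation \<Gamma> y) y (mesh_relation R \<Gamma> y) = \<zero>"
proof -
  obtain q i where y: "y = (q, i)" by (cases y)
  have q: "1 \<le> q" "q \<le> n" using assms y by auto
  have opposite: "weight [Star (q - 1) (i + 1), Arr (q - 1) i]
      \<oplus> weight [Arr q (i + 1), Star q (i + 1)] = \<zero>"
    using q by (auto simp: arrow_weight_def l_neg r_neg)
  show "mesh_relation R \<Gamma> y \<in> carrier (paths (translation \<Gamma> y) y)"
    using q mesh_walks[of q i] two_le_n by (auto simp: y mesh_relation_eq)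
  show "ev (translation \<Gamma> y) y (mesh_relation R \<Gamma> y) = \<zero>"
    using q mesh_walks[of q i] opposite two_le_n
    by (auto simp: y mesh_relation_eq ev_basis hammock_def arrs_def stars_def)
qed

text \<open>Induction over the generation of the ideal: \<open>ev\<close> is linear, and on a
  composite it is either zero or the product of the two values.\<close>

lemma mesh_ideal_ev:
  assumes "f \<in> I x y"
  shows "f \<in> carrier (paths x y)" "ev x y f = \<zero>"
proof -
  have "two_sided_ideal R PC
       (\<lambda>x y. if x = translation \<Gamma> y then {mesh_relation R \<Gamma> y} else {}) x y f"
    using assms by (simp add: mesh_ideal_def)
  then have "f \<in> carrier (paths x y) \<and> ev x y f = \<zero>"
  proof induction
    case (generator x y f)
    then show ?case using ev_mesh_relation[of y] by (auto split: if_splits)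
  qed (auto simp: Comp_paths)
  then show "f \<in> carrier (paths x y)" "ev x y f = \<zero>" by auto
qed

section \<open>Closure of the mesh ideal and congruence modulo it\<close>

lemma mesh_ideal_zero:
  "fst x \<in> {1..n} \<Longrightarrow> fst y \<in> {1..n} \<Longrightarrow> (\<lambda>p. \<zero>) \<in> I x y"
  using two_sided_ideal.zero[of x PC y R] by (cases x; cases y) (auto simp: mesh_ideal_def)

lemma mesh_ideal_add:
  "f \<in> I x y \<Longrightarrow> g \<in> I x y \<Longrightarrow> (\<lambda>p. f p \<oplus> g p) \<in> I x y"
  using two_sided_ideal.add[of R PC _ x y f g] by (auto simp: mesh_ideal_def)

lemma mesh_ideal_smult:
  "f \<in> I x y \<Longrightarrow> c \<in> carrier R \<Longrightarrow> (\<lambda>p. c \<otimes> f p) \<in> I x y"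
  using two_sided_ideal.smult[of c R PC _ x y f] by (auto simp: mesh_ideal_def)

lemma mesh_ideal_Comp_left:
  "f \<in> I x y \<Longrightarrow> g \<in> carrier (paths y z) \<Longrightarrow> fst z \<in> {1..n} \<Longrightarrow> Comp PC x y z g f \<in> I x z"
  using two_sided_ideal.comp_left[of R PC _ x y f z g]
  by (cases z) (auto simp: mesh_ideal_def)

lemma mesh_ideal_Comp_right:
  "g \<in> I y z \<Longrightarrow> f \<in> carrier (paths x y) \<Longrightarrow> fst x \<in> {1..n} \<Longrightarrow> Comp PC x y z g f \<in> I x z"
  using two_sided_ideal.comp_right[of R PC _ y z g x f]
  by (cases x) (auto simp: mesh_ideal_def)

lemma mesh_relation_in_ideal:
  assumes "1 \<le> q" "q \<le> n"
  shows "mesh_relation R \<Gamma> (q, i) \<in> I (q, i + 1) (q, i)"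
  unfolding mesh_ideal_def mem_Collect_eq
  by (rule two_sided_ideal.generator) (use assms in auto)

text \<open>Congruence is encoded as membership of the difference, so transitivity is a telescoping
  sum.\<close>

lemma mesh_ideal_trans:
  assumes "(\<lambda>p. f p \<ominus> g p) \<in> I x y" "(\<lambda>p. g p \<ominus> h p) \<in> I x y"
    and "range f \<subseteq> carrier R" "range g \<subseteq> carrier R" "range h \<subseteq> carrier R"
  shows "(\<lambda>p. f p \<ominus> h p) \<in> I x y"
proof -
  have "(f p \<ominus> g p) \<oplus> (g p \<ominus> h p) = f p \<ominus> h p" for p
  proof -
    have "f p \<in> carrier R" "g p \<in> carrier R" "h p \<in> carrier R" using assms(3-5) by auto
    then show ?thesis by (simp add: a_minus_def a_assoc r_neg1)
  qed
  then show ?thesis using mesh_ideal_add[OF assms(1,2)] by simp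
qed

lemma mesh_ideal_sym:
  assumes "(\<lambda>p. f p \<ominus> g p) \<in> I x y"
    and "range f \<subseteq> carrier R" "range g \<subseteq> carrier R"
  shows "(\<lambda>p. g p \<ominus> f p) \<in> I x y"
proof -
  have "(\<ominus> \<one>) \<otimes> (f p \<ominus> g p) = g p \<ominus> f p" for p
  proof -
    have "f p \<in> carrier R" "g p \<in> carrier R" using assms(2,3) by auto
    then show ?thesis by (simp add: a_minus_def l_minus minus_add a_comm)
  qed
  then show ?thesis using mesh_ideal_smult[OF assms(1), of "\<ominus> \<one>"] by simp
qed

text \<open>Each path is rescaled by its own sign, so that congruences between paths carry no signs
  and \<open>ev\<close> takes the value one inside the hammock.\<close>

definition npath :: "nat rep_arrow list \<Rightarrow> nat rep_arrow list \<Rightarrow> 'a" where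
  "npath p = (\<lambda>t. weight p \<otimes> basis_elem R p t)"

lemma npath_range: "range (npath p) \<subseteq> carrier R"
  by (auto simp: npath_def)

lemma npath_apply_closed [simp]: "npath p t \<in> carrier R"
  by (simp add: npath_def)

lemma npath_closed [simp]: "p \<in> walks n x y \<Longrightarrow> npath p \<in> carrier (paths x y)"
  by (simp add: npath_def)

lemma basis_eq_npath: "basis_elem R p = (\<lambda>t. weight p \<otimes> npath p t)"
  by (simp add: npath_def weight_square_cancel)

lemma ev_npath: "p \<in> walks n x y \<Longrightarrow> ev x y (npath p) = (if hammock n x y then \<one> else \<zero>)"
  by (simp add: npath_def ev_basis)

lemma npath_append: "Comp PC x y z (npath q) (npath p) = npath (p @ q)"
  by (simp add: npath_def Comp_smult_left Comp_smult_right Comp_basis basis_range weight_append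
      image_subset_iff m_ac)

lemma npath_cong_append:
  assumes "(\<lambda>t. npath p t \<ominus> npath p' t) \<in> I x y" "q \<in> walks n y z"
  shows "(\<lambda>t. npath (p @ q) t \<ominus> npath (p' @ q) t) \<in> I x z"
proof -
  have "(\<lambda>t. npath p t \<ominus> npath p' t) = (\<lambda>t. npath p t \<oplus> (\<ominus> \<one>) \<otimes> npath p' t)"
    by (simp add: a_minus_def l_minus)
  then have "Comp PC x y z (npath q) (\<lambda>t. npath p t \<ominus> npath p' t) =
      (\<lambda>t. npath (p @ q) t \<ominus> npath (p' @ q) t)"
    by (simp add: Comp_add_right Comp_smult_right npath_append npath_range image_subset_iff)
      (simp add: a_minus_def l_minus)
  moreover have "fst z \<in> {1..n}" using assms(2) awalk_verts by blast
  ultimately show ?thesis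
    using mesh_ideal_Comp_left[OF assms(1), of "npath q" z] assms(2) by simp
qed

text \<open>The mesh relation after \<open>r\<close> is a sum of two paths of opposite signs.
  Multiplied by the sign of the first, it becomes a difference of normalized paths.\<close>

lemma npath_cong_mesh:
  assumes "r \<in> walks n x (q, i + 1)" "1 < q" "q < n"
  shows "(\<lambda>t. npath (r @ [Star (q - 1) (i + 1), Arr (q - 1) i]) t \<ominus>
    npath (r @ [Arr q (i + 1), Star q (i + 1)]) t) \<in> I x (q, i)"
proof -
  let ?s = "[Star (q - 1) (i + 1), Arr (q - 1) i]" and ?t = "[Arr q (i + 1), Star q (i + 1)]"
  have "Comp PC x (q, i + 1) (q, i) (mesh_relation R \<Gamma> (q, i)) (basis_elem R r) \<in> I x (q, i)"
    using assms by (intro mesh_ideal_Comp_right mesh_relation_in_ideal) (auto dest: awalk_verts)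
  also have "Comp PC x (q, i + 1) (q, i) (mesh_relation R \<Gamma> (q, i)) (basis_elem R r) =
      (\<lambda>t. basis_elem R (r @ ?s) t \<oplus> basis_elem R (r @ ?t) t)"
    using assms by (simp add: mesh_relation_eq Comp_add_left Comp_basis basis_range)
  finally have "(\<lambda>t. (weight r \<otimes> weight ?s) \<otimes>
      (basis_elem R (r @ ?s) t \<oplus> basis_elem R (r @ ?t) t)) \<in> I x (q, i)"
    by (rule mesh_ideal_smult) simp
  moreover have "weight (r @ ?t) = \<ominus> (weight r \<otimes> weight ?s)"
    using assms by (auto simp: weight_append arrow_weight_def l_minus r_minus)
  moreover have "weight (r @ ?s) = weight r \<otimes> weight ?s"
    by (rule weight_append)
  ultimately show ?thesis
    by (simp add: npath_def a_minus_def r_distr l_minus del: weight.simps)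
qed

text \<open>Induction on the length. If two walks end in different arrows \<open>b\<close> and \<open>c\<close>, then
  \<open>x\<close> admits a walk \<open>r\<close> to the vertex of the mesh of \<open>b\<close> and \<open>c\<close>, and both can be compared with
  the extensions of \<open>r\<close> through that mesh.\<close>

lemma npath_cong:
  assumes "p \<in> walks n x y" "p' \<in> walks n x y"
  shows "(\<lambda>t. npath p t \<ominus> npath p' t) \<in> I x y"
  using assms
proof (induction "length p" arbitrary: p p' y)
  case 0
  then have "p = []" "p' = []"
    using awalk_length[of n x p y] awalk_length[of n x p' y] by auto
  moreover have "fst x \<in> {1..n}" "fst y \<in> {1..n}" using 0 awalk_verts by blast+
  ultimately show ?case using mesh_ideal_zero by (simp add: a_minus_def r_neg)
next
  case (Suc k)
  obtain q i where y: "y = (q, i)" by (cases y)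
  have "length p' = Suc k"
    using Suc.hyps(2) Suc.prems awalk_length[of n x p y] awalk_length[of n x p' y] by auto
  then obtain w' c where p': "p' = w' @ [c]" "length w' = k"
    by (cases p' rule: rev_cases) auto
  obtain w b where p: "p = w @ [b]" "length w = k"
    using Suc.hyps(2) by (cases p rule: rev_cases) auto
  have last: "w \<in> walks n x (tail (quiver \<Gamma>) b)" "b \<in> in_arcs (quiver \<Gamma>) y"
    if "w @ [b] \<in> walks n x y" for w b
    using that by (auto simp: awalk_append awalk_Cons awalk_Nil in_arcs_def)
  \<comment> \<open>Fixing which walk ends in \<open>Arr\<close> costs nothing: the other order
    follows by \<open>mesh_ideal_sym\<close>.\<close>
  have mixed: "(\<lambda>t. npath (w @ [Arr (q - 1) i]) t \<ominus> npath (w' @ [Star q (i + 1)]) t) \<in> I x y"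
    if w: "w @ [Arr (q - 1) i] \<in> walks n x y" "w' @ [Star q (i + 1)] \<in> walks n x y"
      and len: "length w = k" "length w' = k" for w w'
  proof -
    have q: "1 < q" "q < n" and ww: "w \<in> walks n x (q - 1, i)" "w' \<in> walks n x (q + 1, i + 1)"
      using last[OF w(1)] last[OF w(2)]
      by (auto simp: y in_arcs_repetitive_linear split: if_splits)
    have "fst x \<in> {1..n}" using ww awalk_verts by blast
    \<comment> \<open>A walk to the corner \<open>(q, i + 1)\<close> has as many \<open>Arr\<close>
      as one to \<open>(q - 1, i)\<close> and as many \<open>Star\<close> as one to
      \<open>(q + 1, i + 1)\<close>, so both counts are nonnegative.\<close>
    then obtain r where r: "r \<in> walks n x (q, i + 1)"
      using awalk_exists[of n x "(q, i + 1)"] two_le_n q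
        awalk_length[of n x w "(q - 1, i)"] awalk_length[of n x w' "(q + 1, i + 1)"] ww
      by (auto simp: arrs_def stars_def)
    let ?s = "[Star (q - 1) (i + 1)]" and ?s' = "[Arr (q - 1) i]"
    let ?t = "[Arr q (i + 1)]" and ?t' = "[Star q (i + 1)]"
    have st: "?s \<in> walks n (q, i + 1) (q - 1, i)" "?s' \<in> walks n (q - 1, i) y"
      "?t \<in> walks n (q, i + 1) (q + 1, i + 1)" "?t' \<in> walks n (q + 1, i + 1) y"
      using q by (auto simp: awalk_Cons awalk_Nil y)
    have "r @ ?s \<in> walks n x (q - 1, i)" "r @ ?t \<in> walks n x (q + 1, i + 1)"
      using r st awalk_append by blast+
    \<comment> \<open>The induction hypothesis asks for length \<open>k\<close> of its first walk,
      which is \<open>r @ ?t\<close> in the comparison with \<open>w'\<close>.\<close>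
    moreover have "k = length (r @ ?t)"
      using calculation(2) ww(2) len(2) awalk_length[of n x "r @ ?t" "(q + 1, i + 1)"]
        awalk_length[of n x w' "(q + 1, i + 1)"] by simp
    ultimately have
      "(\<lambda>t. npath w t \<ominus> npath (r @ ?s) t) \<in> I x (q - 1, i)"
      "(\<lambda>t. npath (r @ ?t) t \<ominus> npath w' t) \<in> I x (q + 1, i + 1)"
      using Suc.hyps(1)[OF len(1)[symmetric] ww(1)] Suc.hyps(1)[OF _ _ ww(2)] by blast+
    then have
      "(\<lambda>t. npath (w @ ?s') t \<ominus> npath ((r @ ?s) @ ?s') t) \<in> I x y"
      "(\<lambda>t. npath ((r @ ?t) @ ?t') t \<ominus> npath (w' @ ?t') t) \<in> I x y"
      using npath_cong_append st by blast+
    then have 1: "(\<lambda>t. npath (w @ ?s') t \<ominus> npath (r @ ?s @ ?s') t) \<in> I x y"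
      and 3: "(\<lambda>t. npath (r @ ?t @ ?t') t \<ominus> npath (w' @ ?t') t) \<in> I x y"
      by simp_all
    have 2: "(\<lambda>t. npath (r @ ?s @ ?s') t \<ominus> npath (r @ ?t @ ?t') t) \<in> I x y"
      using npath_cong_mesh[OF r q] by (simp add: y)
    show ?thesis
      by (rule mesh_ideal_trans[OF 1 mesh_ideal_trans[OF 2 3]]) (rule npath_range)+
  qed
  have bc: "b \<in> in_arcs (quiver \<Gamma>) y" "c \<in> in_arcs (quiver \<Gamma>) y"
    using last Suc.prems p p' by blast+
  show ?case
  proof (cases "b = c")
    case True
    have "w \<in> walks n x (tail (quiver \<Gamma>) b)" "w' \<in> walks n x (tail (quiver \<Gamma>) b)"
      using last Suc.prems p p' True by blast+
    then have "(\<lambda>t. npath w t \<ominus> npath w' t) \<in> I x (tail (quiver \<Gamma>) b)"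
      using Suc.hyps(1) p(2) by blast
    moreover have "[b] \<in> walks n (tail (quiver \<Gamma>) b) y"
      using bc(1) Suc.prems(1) awalk_verts by (auto simp: awalk_Cons awalk_Nil in_arcs_def)
    ultimately show ?thesis using npath_cong_append p(1) p'(1) True by blast
  next
    case False
    then consider "b = Arr (q - 1) i" "c = Star q (i + 1)" | "c = Arr (q - 1) i" "b = Star q (i + 1)"
      using bc by (auto simp: y in_arcs_repetitive_linear split: if_splits)
    then show ?thesis
    proof cases
      case 1
      then show ?thesis using mixed[of w w'] Suc.prems p p' by simp
    next
      case 2
      then have "(\<lambda>t. npath p' t \<ominus> npath p t) \<in> I x y"
        using mixed[of w' w] Suc.prems p p' by simp
      then show ?thesis by (rule mesh_ideal_sym) (rule npath_range)+
    qed
  qed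
qed

lemma basis_in_ideal_iff_npath:
  "basis_elem R p \<in> I x y \<longleftrightarrow> npath p \<in> I x y"
proof
  show "npath p \<in> I x y" if "basis_elem R p \<in> I x y"
    using mesh_ideal_smult[OF that, of "weight p"] by (simp add: npath_def)
  show "basis_elem R p \<in> I x y" if "npath p \<in> I x y"
    using mesh_ideal_smult[OF that, of "weight p"] by (subst basis_eq_npath) simp
qed

section \<open>Paths through boundary meshes\<close>

lemma npath_in_ideal_append:
  assumes "npath q \<in> I u v" "p \<in> walks n x u" "r \<in> walks n v y"
  shows "npath (p @ q @ r) \<in> I x y"
proof -
  have "npath (p @ q) \<in> I x v"
    using mesh_ideal_Comp_right[OF assms(1), of "npath p" x] assms(2)
    by (auto simp: npath_append dest: awalk_verts)
  from mesh_ideal_Comp_left[OF this, of "npath r" y] show ?thesis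
    using assms(3) by (auto simp: npath_append dest: awalk_verts)
qed

text \<open>Outside of the hammock there is a walk through the boundary mesh at level \<open>n\<close>
  (too many arrows \<open>Arr\<close>) or at level \<open>1\<close> (too many arrows \<open>Star\<close>).\<close>

lemma npath_outside_hammock:
  assumes "p \<in> walks n x y" "\<not> hammock n x y"
  shows "npath p \<in> I x y"
proof -
  have v: "fst x \<in> {1..n}" "fst y \<in> {1..n}" using assms(1) awalk_verts by blast+
  obtain a j where x: "x = (a, j)" by (cases x)
  obtain q i where y: "y = (q, i)" by (cases y)
  have nonneg: "0 \<le> arrs x y" "0 \<le> stars x y" using awalk_length assms(1) by blast+
  then consider "arrs x y > int n - int a" | "stars x y \<ge> int a"
    using assms(2) by (fastforce simp: hammock_def x)
  then obtain p0 where p0: "p0 \<in> walks n x y" "npath p0 \<in> I x y"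
  proof cases
    case 1
    have "mesh_relation R \<Gamma> (n, j - 1) \<in> I (n, j) (n, j - 1)"
      using mesh_relation_in_ideal[of n "j - 1"] two_le_n by simp
    then have m: "npath [Star (n - 1) j, Arr (n - 1) (j - 1)] \<in> I (n, j) (n, j - 1)"
      using two_le_n by (simp add: mesh_relation_eq basis_in_ideal_iff_npath)
    have w: "[Star (n - 1) j, Arr (n - 1) (j - 1)] \<in> walks n (n, j) (n, j - 1)"
      using mesh_walks(1)[of n "j - 1"] two_le_n by simp
    obtain p1 where p1: "p1 \<in> walks n x (n, j)"
      using awalk_exists[of n x "(n, j)"] two_le_n v by (auto simp: x arrs_def stars_def)
    \<comment> \<open>\<open>arrs (n, j - 1) y\<close> equals \<open>arrs x y - (n - a) - 1\<close>,
      which is nonnegative by the case assumption.\<close>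
    obtain p2 where p2: "p2 \<in> walks n (n, j - 1) y"
      using awalk_exists[of n "(n, j - 1)" y] two_le_n v nonneg 1
      by (auto simp: x y arrs_def stars_def)
    show ?thesis
      by (rule that[OF _ npath_in_ideal_append[OF m p1 p2]]) (use p1 p2 w awalk_append in blast)
  next
    case 2
    \<comment> \<open>From \<open>(a, j)\<close>, a descent by \<open>a - 1\<close> arrows
      \<open>Star\<close> reaches \<open>(1, j - a + 1)\<close>. The boundary mesh there ends at
      \<open>(1, j - a)\<close>, after \<open>a\<close> arrows \<open>Star\<close> in total.\<close>
    let ?i = "j - int a"
    have "mesh_relation R \<Gamma> (1, ?i) \<in> I (1, ?i + 1) (1, ?i)"
      using mesh_relation_in_ideal[of 1 ?i] two_le_n by simp
    then have m: "npath [Arr 1 (?i + 1), Star 1 (?i + 1)] \<in> I (1, ?i + 1) (1, ?i)"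
      using two_le_n by (simp add: mesh_relation_eq basis_in_ideal_iff_npath)
    have w: "[Arr 1 (?i + 1), Star 1 (?i + 1)] \<in> walks n (1, ?i + 1) (1, ?i)"
      using mesh_walks(2)[of 1 ?i] two_le_n by simp
    obtain p1 where p1: "p1 \<in> walks n x (1, ?i + 1)"
      using awalk_exists[of n x "(1, ?i + 1)"] two_le_n v by (auto simp: x arrs_def stars_def)
    obtain p2 where p2: "p2 \<in> walks n (1, ?i) y"
      using awalk_exists[of n "(1, ?i)" y] two_le_n v nonneg 2
      by (auto simp: x y arrs_def stars_def)
    show ?thesis
      by (rule that[OF _ npath_in_ideal_append[OF m p1 p2]]) (use p1 p2 w awalk_append in blast)
  qed
  \<comment> \<open>The given \<open>p\<close> may avoid the boundary mesh, but it is congruent to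
    \<open>p0\<close>.\<close>
  have "(\<lambda>t. (npath p t \<ominus> npath p0 t) \<oplus> npath p0 t) \<in> I x y"
    by (rule mesh_ideal_add[OF npath_cong[OF assms(1) p0(1)] p0(2)])
  then show ?thesis by (simp add: a_minus_def a_assoc l_neg npath_range)
qed

text \<open>One path spans the quotient. By linearity a single path \<open>q\<close> has to be
  compared with \<open>p\<close>: inside the hammock they agree up to sign modulo the ideal, outside
  of it \<open>q\<close> itself lies in the ideal.\<close>

lemma ev_cong:
  assumes "f \<in> carrier (paths x y)" "p \<in> walks n x y"
  shows "(\<lambda>t. f t \<ominus> ev x y f \<otimes> npath p t) \<in> I x y"
  using assms(1)
proof (induction f rule: free_module_induct)
  case zero
  have "fst x \<in> {1..n}" "fst y \<in> {1..n}" using assms(2) awalk_verts by blast+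
  then show ?case using mesh_ideal_zero by (simp add: a_minus_def)
next
  case (add f r q)
  have "(\<lambda>t. npath q t \<ominus> ev x y (npath q) \<otimes> npath p t) \<in> I x y"
    using npath_cong[OF add.hyps(3) assms(2)] npath_outside_hammock[OF add.hyps(3)]
    by (simp add: ev_npath[OF add.hyps(3)] a_minus_def)
  \<comment> \<open>The factor \<open>weight q\<close> turns the normalized path back into the plain
    one.\<close>
  then have "(\<lambda>t. (r \<otimes> weight q) \<otimes> (npath q t \<ominus> ev x y (npath q) \<otimes> npath p t)) \<in> I x y"
    using add.hyps by (intro mesh_ideal_smult) auto
  from mesh_ideal_add[OF add.IH this]
  have "(\<lambda>t. (f t \<ominus> ev x y f \<otimes> npath p t) \<oplus>
     (r \<otimes> weight q) \<otimes> (npath q t \<ominus> ev x y (npath q) \<otimes> npath p t)) \<in> I x y" .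
  also have "(\<lambda>t. (f t \<ominus> ev x y f \<otimes> npath p t) \<oplus>
     (r \<otimes> weight q) \<otimes> (npath q t \<ominus> ev x y (npath q) \<otimes> npath p t)) =
     (\<lambda>t. (f t \<oplus> r \<otimes> basis_elem R q t) \<ominus>
       ev x y (\<lambda>t. f t \<oplus> r \<otimes> basis_elem R q t) \<otimes> npath p t)"
  proof
    fix t
    have c: "f t \<in> carrier R" "ev x y f \<in> carrier R" "ev x y (npath q) \<in> carrier R"
      "r \<in> carrier R" "npath p t \<in> carrier R" "npath q t \<in> carrier R" "weight q \<in> carrier R"
      using add.hyps by auto
    have e: "ev x y (\<lambda>t. f t \<oplus> r \<otimes> basis_elem R q t) =
        ev x y f \<oplus> (r \<otimes> weight q) \<otimes> ev x y (npath q)"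
      using add.hyps by (simp add: ev_basis ev_npath)
    have b: "r \<otimes> basis_elem R q t = (r \<otimes> weight q) \<otimes> npath q t"
      using c by (simp add: npath_def m_assoc weight_square_cancel)
    show "(f t \<ominus> ev x y f \<otimes> npath p t) \<oplus>
       (r \<otimes> weight q) \<otimes> (npath q t \<ominus> ev x y (npath q) \<otimes> npath p t) =
       (f t \<oplus> r \<otimes> basis_elem R q t) \<ominus>
         ev x y (\<lambda>t. f t \<oplus> r \<otimes> basis_elem R q t) \<otimes> npath p t"
      unfolding e b using c
      by (simp add: a_minus_def l_distr r_distr minus_add l_minus r_minus a_ac m_ac)
  qed
  finally show ?case .
qed

lemma mesh_ideal_eq:
  assumes "fst x \<in> {1..n}" "fst y \<in> {1..n}"
  shows "I x y = {f \<in> carrier (paths x y). ev x y f = \<zero>}"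
proof (intro Set.equalityI subsetI)
  fix f assume f: "f \<in> {f \<in> carrier (paths x y). ev x y f = \<zero>}"
  show "f \<in> I x y"
  \<comment> \<open>Without walks there is no reference path for \<open>ev_cong\<close>, but then
    \<open>f\<close> is zero.\<close>
  proof (cases "walks n x y = {}")
    case True
    then have "f = (\<lambda>p. \<zero>)" using f free_module_outside[of f "walks n x y"] by auto
    then show ?thesis using mesh_ideal_zero assms by simp
  next
    case False
    then obtain p where "p \<in> walks n x y" by blast
    moreover have "f \<in> carrier (paths x y)" "ev x y f = \<zero>" using f by auto
    ultimately show ?thesis using ev_cong[of f x y p] by (simp add: a_minus_def)
  qed
qed (auto dest: mesh_ideal_ev)

section \<open>Mesh homology of the representable functors\<close>

abbreviation "MC \<equiv> mesh_category R \<Gamma>"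

section \<open>Coordinates on the hom modules of the mesh category\<close>

text \<open>Morphisms of the mesh category are cosets. Since the ideal is the kernel of
  \<open>ev\<close>, these are the fibres over the attained values, and \<open>c\<close> serves as a
  coordinate.\<close>

definition fiber :: "nat \<times> int \<Rightarrow> nat \<times> int \<Rightarrow> 'a \<Rightarrow> (nat rep_arrow list \<Rightarrow> 'a) set" where
  "fiber x y c = {f \<in> carrier (paths x y). ev x y f = c}"

text \<open>The range of the coordinate: a copy of the hom module inside the ring.\<close>

definition vals :: "nat \<times> int \<Rightarrow> nat \<times> int \<Rightarrow> 'a set" where
  "vals x y = (if hammock n x y then carrier R else {\<zero>})"

definition act :: "nat \<times> int \<Rightarrow> nat rep_arrow \<Rightarrow> 'a \<Rightarrow> 'a" where
  "act x b c = (if hammock n x (head (quiver \<Gamma>) b) then arrow_weight b \<otimes> c else \<zero>)"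

lemma vals_carrier: "c \<in> vals x y \<Longrightarrow> c \<in> carrier R"
  by (auto simp: vals_def split: if_splits)

lemma vals_zero [simp]: "\<zero> \<in> vals x y"
  by (simp add: vals_def)

lemma vals_add: "c \<in> vals x y \<Longrightarrow> d \<in> vals x y \<Longrightarrow> c \<oplus> d \<in> vals x y"
  by (auto simp: vals_def split: if_splits)

lemma vals_uminus: "c \<in> vals x y \<Longrightarrow> \<ominus> c \<in> vals x y"
  by (auto simp: vals_def split: if_splits)

lemma act_vals: "c \<in> carrier R \<Longrightarrow> act x b c \<in> vals x (head (quiver \<Gamma>) b)"
  by (auto simp: act_def vals_def)

lemma act_zero [simp]: "act x b \<zero> = \<zero>"
  by (simp add: act_def)

lemma act_add: "c \<in> carrier R \<Longrightarrow> d \<in> carrier R \<Longrightarrow> act x b (c \<oplus> d) = act x b c \<oplus> act x b d"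
  by (simp add: act_def r_distr)

lemma ev_vals: "f \<in> carrier (paths x y) \<Longrightarrow> ev x y f \<in> vals x y"
  using ev_closed[of f x y] by (auto simp: vals_def ev_def)

lemma fiber_nonempty:
  assumes "fst x \<in> {1..n}" "c \<in> vals x y"
  shows "fiber x y c \<noteq> {}"
proof (cases "hammock n x y")
  case True
  then obtain p where p: "p \<in> walks n x y" using hammock_walk two_le_n assms(1) by blast
  have "(\<lambda>t. c \<otimes> npath p t) \<in> fiber x y c"
    using assms(2) True p ev_smult[OF npath_closed[OF p], of c]
    by (auto simp: fiber_def vals_def ev_npath)
  then show ?thesis by blast
next
  case False
  then have "(\<lambda>t. \<zero>) \<in> fiber x y c" using assms(2) by (auto simp: fiber_def vals_def)
  then show ?thesis by blast
qed

lemma fiber_inj: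
  assumes "fst x \<in> {1..n}" "c \<in> vals x y" "fiber x y c = fiber x y d"
  shows "c = d"
  using fiber_nonempty[OF assms(1,2)] assms(3) by (auto simp: fiber_def)

lemma fiber_zero:
  "fst x \<in> {1..n} \<Longrightarrow> fst y \<in> {1..n} \<Longrightarrow> fiber x y \<zero> = I x y"
  by (simp add: fiber_def mesh_ideal_eq)

lemma abelian_subgroup_mesh_ideal:
  assumes "fst x \<in> {1..n}" "fst y \<in> {1..n}"
  shows "abelian_subgroup (I x y) (paths x y)"
proof -
  interpret M: abelian_group "paths x y"
    by (rule abelian_group_free_module[OF is_cring])
  interpret hom: abelian_group_hom "paths x y" R "ev x y"
    by unfold_locales (auto simp: hom_def)
  have "a_kernel (paths x y) R (ev x y) = I x y"
    by (simp add: a_kernel_def' mesh_ideal_eq[OF assms])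
  then show ?thesis using hom.abelian_subgroup_a_kernel by simp
qed

lemma mesh_ideal_coset:
  assumes "fst x \<in> {1..n}" "fst y \<in> {1..n}" "f \<in> carrier (paths x y)"
  shows "I x y +>\<^bsub>paths x y\<^esub> f = fiber x y (ev x y f)"
proof (intro Set.equalityI subsetI)
  fix g assume "g \<in> I x y +>\<^bsub>paths x y\<^esub> f"
  then show "g \<in> fiber x y (ev x y f)"
    using assms by (auto simp: a_r_coset_def' mesh_ideal_eq fiber_def)
next
  fix g assume g: "g \<in> fiber x y (ev x y f)"
  let ?h = "\<lambda>t. g t \<oplus> (\<ominus> \<one>) \<otimes> f t"
  have gc: "g \<in> carrier (paths x y)" using g by (simp add: fiber_def)
  have "ev x y ?h = ev x y f \<oplus> (\<ominus> \<one>) \<otimes> ev x y f"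
    using g assms(3) by (simp add: fiber_def)
  then have "?h \<in> I x y"
    unfolding mesh_ideal_eq[OF assms(1,2)] using gc assms(3) by (simp add: l_minus[of \<one> "ev x y f"] r_neg)
  moreover have "g = ?h \<oplus>\<^bsub>paths x y\<^esub> f"
    using gc assms(3) by (auto simp: l_minus a_assoc l_neg)
  ultimately show "g \<in> I x y +>\<^bsub>paths x y\<^esub> f"
    unfolding a_r_coset_def' by blast
qed

lemma Hom_mesh_category: "Hom MC x y = quotient_module (paths x y) (I x y)"
  by (simp add: mesh_category_def quotient_cat_def)

lemma Hom_zero: "fst x \<in> {1..n} \<Longrightarrow> fst y \<in> {1..n} \<Longrightarrow> \<zero>\<^bsub>Hom MC x y\<^esub> = fiber x y \<zero>"
  by (simp add: Hom_mesh_category quotient_module_def fiber_zero)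

lemma Hom_carrier:
  assumes "fst x \<in> {1..n}" "fst y \<in> {1..n}"
  shows "carrier (Hom MC x y) = fiber x y ` vals x y"
proof -
  have "carrier (Hom MC x y) = (\<lambda>f. fiber x y (ev x y f)) ` carrier (paths x y)"
    using mesh_ideal_coset[OF assms]
    by (auto simp: Hom_mesh_category quotient_module_def A_RCOSETS_def' image_def)
  also have "\<dots> = fiber x y ` vals x y"
  proof (intro Set.equalityI subsetI)
    fix A assume "A \<in> fiber x y ` vals x y"
    then obtain c where c: "c \<in> vals x y" "A = fiber x y c" by blast
    then obtain f where "f \<in> fiber x y c" using fiber_nonempty[OF assms(1)] by blast
    then show "A \<in> (\<lambda>f. fiber x y (ev x y f)) ` carrier (paths x y)"
      using c(2) by (auto simp: fiber_def)
  qed (use ev_vals in blast)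
  finally show ?thesis .
qed

lemma Hom_add:
  assumes "fst x \<in> {1..n}" "fst y \<in> {1..n}" "c \<in> vals x y" "d \<in> vals x y"
  shows "fiber x y c \<oplus>\<^bsub>Hom MC x y\<^esub> fiber x y d = fiber x y (c \<oplus> d)"
proof -
  interpret abelian_subgroup "I x y" "paths x y"
    by (rule abelian_subgroup_mesh_ideal[OF assms(1,2)])
  obtain f g where f: "f \<in> fiber x y c" and g: "g \<in> fiber x y d"
    using fiber_nonempty assms by blast
  then have fg: "f \<in> carrier (paths x y)" "g \<in> carrier (paths x y)" "ev x y f = c" "ev x y g = d"
    by (auto simp: fiber_def)
  have "fiber x y c \<oplus>\<^bsub>Hom MC x y\<^esub> fiber x y d =
      (I x y +>\<^bsub>paths x y\<^esub> f) <+>\<^bsub>paths x y\<^esub> (I x y +>\<^bsub>paths x y\<^esub> g)"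
    using mesh_ideal_coset[OF assms(1,2)] fg
    by (simp add: Hom_mesh_category quotient_module_def)
  also have "\<dots> = I x y +>\<^bsub>paths x y\<^esub> (f \<oplus>\<^bsub>paths x y\<^esub> g)"
    by (rule a_rcos_sum[OF fg(1,2)])
  also have "\<dots> = fiber x y (c \<oplus> d)"
    using mesh_ideal_coset[OF assms(1,2), of "f \<oplus>\<^bsub>paths x y\<^esub> g"] fg by simp
  finally show ?thesis .
qed

lemma abelian_group_Hom:
  assumes "fst x \<in> {1..n}" "fst y \<in> {1..n}"
  shows "abelian_group (Hom MC x y)"
proof (rule abelian_groupI)
  note [simp] = Hom_carrier[OF assms] Hom_zero[OF assms]
  note add = Hom_add[OF assms]
  fix A assume "A \<in> carrier (Hom MC x y)"
  then obtain c where c: "A = fiber x y c" "c \<in> vals x y" by auto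
  then show "\<exists>B\<in>carrier (Hom MC x y). B \<oplus>\<^bsub>Hom MC x y\<^esub> A = \<zero>\<^bsub>Hom MC x y\<^esub>"
    using vals_uminus[OF c(2)] vals_carrier[OF c(2)]
    by (auto intro!: bexI[of _ "\<ominus> c"] simp: add l_neg)
  show "\<zero>\<^bsub>Hom MC x y\<^esub> \<oplus>\<^bsub>Hom MC x y\<^esub> A = A"
    using c vals_carrier[OF c(2)] by (simp add: add)
qed (use Hom_carrier[OF assms] Hom_add[OF assms] Hom_zero[OF assms] vals_carrier[of _ x y] in
    \<open>auto simp: vals_add a_ac\<close>)

text \<open>Membership of the partial sums in \<open>vals\<close> is carried through the induction
  because \<open>Hom_add\<close> asks for it.\<close>

lemma Hom_finsum:
  assumes "fst x \<in> {1..n}" "fst y \<in> {1..n}" "finite B" "\<And>b. b \<in> B \<Longrightarrow> c b \<in> vals x y"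
  shows "(\<Oplus>\<^bsub>Hom MC x y\<^esub> b\<in>B. fiber x y (c b)) = fiber x y (\<Oplus>b\<in>B. c b)
    \<and> (\<Oplus>b\<in>B. c b) \<in> vals x y"
proof -
  interpret H: abelian_group "Hom MC x y" by (rule abelian_group_Hom[OF assms(1,2)])
  show ?thesis
    using assms(3,4)
  proof (induction B rule: finite_induct)
    case empty
    then show ?case by (simp add: Hom_zero[OF assms(1,2)])
  next
    case (insert b B)
    have c: "c b \<in> vals x y" "\<And>a. a \<in> B \<Longrightarrow> c a \<in> vals x y" using insert.prems by auto
    have "(\<Oplus>b\<in>insert b B. c b) = c b \<oplus> (\<Oplus>b\<in>B. c b)"
      using insert.hyps c vals_carrier[of _ x y] by (intro finsum_insert) auto
    moreover have "(\<Oplus>\<^bsub>Hom MC x y\<^esub> b\<in>insert b B. fiber x y (c b)) =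
        fiber x y (c b) \<oplus>\<^bsub>Hom MC x y\<^esub> (\<Oplus>\<^bsub>Hom MC x y\<^esub> b\<in>B. fiber x y (c b))"
      using insert.hyps c Hom_carrier[OF assms(1,2)] by (intro H.finsum_insert) auto
    ultimately show ?case
      using insert.IH c Hom_add[OF assms(1,2)] by (simp add: vals_add)
  qed
qed

text \<open>The composite of two cosets is a union over all representatives. Every pair contributes
  the same fibre, and nonemptiness of both cosets excludes the empty union.\<close>

lemma Comp_fiber:
  assumes "fst x \<in> {1..n}" "fst y \<in> {1..n}" "fst z \<in> {1..n}" "c \<in> vals x y" "d \<in> vals y z"
  shows "Comp MC x y z (fiber y z d) (fiber x y c) =
    fiber x z (if hammock n x z then d \<otimes> c else \<zero>)"
proof -
  have "I x z +>\<^bsub>paths x z\<^esub> Comp PC x y z g f = fiber x z (if hammock n x z then d \<otimes> c else \<zero>)"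
    if "g \<in> fiber y z d" "f \<in> fiber x y c" for g f
  proof -
    have gf: "g \<in> carrier (paths y z)" "f \<in> carrier (paths x y)" "ev y z g = d" "ev x y f = c"
      using that by (auto simp: fiber_def)
    show ?thesis
      using mesh_ideal_coset[OF assms(1,3) Comp_paths(1)[OF gf(2,1)]] Comp_paths(2)[OF gf(2,1)] gf
      by simp
  qed
  then show ?thesis
    using fiber_nonempty[OF assms(1,4)] fiber_nonempty[OF assms(2,5)]
    by (simp add: mesh_category_def quotient_cat_def)
qed

lemma arrow_map_fiber:
  assumes "fst x \<in> {1..n}" "b \<in> arcs (quiver \<Gamma>)" "c \<in> vals x (tail (quiver \<Gamma>) b)"
  shows "arrow_map R \<Gamma> (representable MC x) b (fiber x (tail (quiver \<Gamma>) b) c) =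
    fiber x (head (quiver \<Gamma>) b) (act x b c)"
proof -
  let ?t = "tail (quiver \<Gamma>) b" and ?h = "head (quiver \<Gamma>) b"
  have v: "fst ?t \<in> {1..n}" "fst ?h \<in> {1..n}" using assms(2) by (cases b; auto)+
  have w: "[b] \<in> walks n ?t ?h" using assms(2) v by (auto simp: awalk_Cons awalk_Nil)
  \<comment> \<open>A single arrow stays in the hammock of its tail, so its coordinate is its sign
    and not the default zero.\<close>
  have h: "hammock n ?t ?h" using assms(2) by (cases b) (auto simp: hammock_def arrs_def stars_def)
  have "mesh_arrow R \<Gamma> b = fiber ?t ?h (arrow_weight b)"
    using mesh_ideal_coset[OF v, of "basis_elem R [b]"] w h
    by (simp add: mesh_arrow_def Let_def ev_basis)
  moreover have "arrow_weight b \<in> vals ?t ?h" using h by (simp add: vals_def)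
  ultimately show ?thesis
    using Comp_fiber[OF assms(1) v assms(3)]
    by (simp add: arrow_map_def representable_def act_def)
qed

section \<open>Exactness of the mesh complex\<close>

text \<open>If the translate of \<open>y\<close> lies in the hammock of \<open>x\<close>, a preimage
  is read off from one component. If not, at most one middle vertex lies in the hammock; when one
  does, so does \<open>y\<close>, and the vanishing sum forces that component to be zero.\<close>

lemma exact_at_middle:
  assumes "fst x \<in> {1..n}" "fst y \<in> {1..n}"
  defines "B \<equiv> in_arcs (quiver \<Gamma>) y"
  assumes c: "\<And>b. b \<in> B \<Longrightarrow> c b \<in> vals x (tail (quiver \<Gamma>) b)"
    and sum: "(\<Oplus>b\<in>B. act x b (c b)) = \<zero>"
  shows "\<exists>d\<in>vals x (translation \<Gamma> y). \<forall>b\<in>B. act x (semitranslation \<Gamma> b) d = c b"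
proof -
  obtain q i where y: "y = (q, i)" by (cases y)
  have q: "1 \<le> q" "q \<le> n" using assms(2) y by auto
  let ?b = "Arr (q - 1) i" and ?b' = "Star q (i + 1)"
  let ?h = "hammock n x (q - 1, i)" and ?h' = "hammock n x (q + 1, i + 1)"
  let ?ht = "hammock n x (q, i + 1)" and ?hy = "hammock n x (q, i)"
  \<comment> \<open>\<open>e\<close> is the sign of \<open>Star q\<close>; for \<open>q > 1\<close>
    the sign of \<open>Star (q - 1)\<close> is its negative.\<close>
  define e where "e = (if even q then \<one> else \<ominus> \<one>)"
  \<comment> \<open>Components at the missing vertex of a boundary mesh default to zero, so one
    two-term equation covers all meshes.\<close>
  define c1 where "c1 = (if ?h then c ?b else \<zero>)"
  define c2 where "c2 = (if ?h' then c ?b' else \<zero>)"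
  have B: "B = (if 1 < q then {?b} else {}) \<union> (if q < n then {?b'} else {})"
    using q by (simp add: B_def y in_arcs_repetitive_linear)
  \<comment> \<open>The hammock bounds keep the level between 1 and \<open>n\<close>, so they fail
    at the nonexistent levels 0 and \<open>n + 1\<close>.\<close>
  have range: "?h \<Longrightarrow> 1 < q" "?h' \<Longrightarrow> q < n"
    using q assms(1) by (auto simp: hammock_def arrs_def stars_def)
  have c1: "?b \<in> B \<Longrightarrow> c ?b = c1" and c2: "?b' \<in> B \<Longrightarrow> c ?b' = c2"
    using c[of ?b] c[of ?b'] q
    by (auto simp: c1_def c2_def vals_def B split: if_splits)
  have carr: "c1 \<in> carrier R" "c2 \<in> carrier R" "e \<in> carrier R"
    using c[of ?b] c[of ?b'] q range by (auto simp: c1_def c2_def B vals_def e_def split: if_splits)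
  have both: "?h \<Longrightarrow> ?h' \<Longrightarrow> ?ht \<and> ?hy" "?h \<Longrightarrow> \<not> ?ht \<Longrightarrow> ?hy" "?h' \<Longrightarrow> \<not> ?ht \<Longrightarrow> ?hy"
    using q by (auto simp: hammock_def arrs_def stars_def)
  \<comment> \<open>If \<open>y\<close> is outside the hammock, all arrows into it act by zero and
    \<open>sum\<close> carries no information.\<close>
  have s: "c1 \<oplus> e \<otimes> c2 = \<zero>" if ?hy
  proof -
    have act: "act x ?b c1 = c1" if "1 < q"
      using that \<open>?hy\<close> carr by (simp add: act_def arrow_weight_def)
    have act': "act x ?b' c2 = e \<otimes> c2"
      using \<open>?hy\<close> by (simp add: act_def arrow_weight_def e_def)
    consider "q = 1" "q < n" | "1 < q" "q = n" | "1 < q" "q < n" using q two_le_n by linarith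
    then show ?thesis
    proof cases
      case 1
      then have "B = {?b'}" by (simp add: B)
      moreover have "c1 = \<zero>" using 1 range by (auto simp: c1_def)
      ultimately show ?thesis using sum c2 act' carr by simp
    next
      case 2
      then have "B = {?b}" by (simp add: B)
      moreover have "c2 = \<zero>" using 2 range by (auto simp: c2_def)
      ultimately show ?thesis using sum c1 act 2 carr by simp
    next
      case 3
      then have "B = {?b, ?b'}" by (auto simp: B)
      then show ?thesis using sum c1 c2 act act' 3 carr by simp
    qed
  qed
  have witness: ?thesis
    if "d \<in> vals x (q, i + 1)" "1 < q \<Longrightarrow> act x (Star (q - 1) (i + 1)) d = c1"
      "q < n \<Longrightarrow> act x (Arr q (i + 1)) d = c2" for d
    using that c1 c2 by (intro bexI[of _ d]) (auto simp: B y)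
  have cancel: "e \<otimes> (e \<otimes> a) = a" if "a \<in> carrier R" for a
    using that by (simp add: e_def l_minus r_minus)
  show ?thesis
  proof (cases "?ht")
    case False
    have "c1 = \<zero> \<and> c2 = \<zero>"
    proof (cases "?h \<or> ?h'")
      case True
      then have h: ?hy and or: "c1 = \<zero> \<or> c2 = \<zero>" using both False by (auto simp: c1_def c2_def)
      from or show ?thesis
      proof
        assume "c1 = \<zero>"
        then have "e \<otimes> c2 = \<zero>" using s[OF h] carr by simp
        then show ?thesis using \<open>c1 = \<zero>\<close> cancel[of c2] carr by simp
      next
        assume "c2 = \<zero>"
        then show ?thesis using s[OF h] carr by simp
      qed
    qed (simp add: c1_def c2_def)
    then show ?thesis by (intro witness[of \<zero>]) auto
  next
    case True
    show ?thesis
    proof (cases "?h")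
      case h: True
      show ?thesis
      \<comment> \<open>\<open>Star (q - 1)\<close> acts by the negative of \<open>e\<close>, which
        determines the preimage of \<open>c1\<close>. As \<open>Arr\<close> acts with sign one, the
        equation \<open>s\<close> makes the same element fit \<open>c2\<close>.\<close>
      proof (rule witness[of "\<ominus> (e \<otimes> c1)"])
        show "\<ominus> (e \<otimes> c1) \<in> vals x (q, i + 1)"
          using True carr by (simp add: vals_def)
        show "act x (Star (q - 1) (i + 1)) (\<ominus> (e \<otimes> c1)) = c1" if "1 < q"
          using that h carr by (auto simp: act_def arrow_weight_def e_def l_minus r_minus)
        have "\<ominus> (e \<otimes> c1) = c2" if ?h'
        proof -
          have "c1 = \<ominus> (e \<otimes> c2)"
            using s both(1)[OF h that] carr by (metis m_closed minus_equality minus_minus)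
          then show ?thesis using carr cancel[of c2] by (simp add: r_minus)
        qed
        then show "act x (Arr q (i + 1)) (\<ominus> (e \<otimes> c1)) = c2"
          using carr by (auto simp: act_def arrow_weight_def c2_def)
      qed
    next
      case h: False
      \<comment> \<open>Here \<open>c1\<close> is zero by default and \<open>Arr\<close> acts with
        sign one, so \<open>c2\<close> serves as its own preimage.\<close>
      have "act x (Arr q (i + 1)) c2 = c2"
        using carr by (auto simp: act_def arrow_weight_def c2_def)
      then show ?thesis
        using True carr h by (intro witness[of c2]) (auto simp: vals_def act_def c1_def)
    qed
  qed
qed

text \<open>In coordinates \<open>exact_at_middle\<close> places the kernel inside the image. Hence
  every coset of the image by a kernel element is the image itself.\<close>

lemma mesh_homology_trivial:
  assumes x: "fst x \<in> {1..n}" and y: "fst y \<in> {1..n}"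
  defines "H \<equiv> mesh_homology R \<Gamma> (representable MC x) y"
  shows "carrier H = {\<zero>\<^bsub>H\<^esub>}"
proof -
  let ?t = "tail (quiver \<Gamma>)" and ?s = "semitranslation \<Gamma>"
  define B where "B = in_arcs (quiver \<Gamma>) y"
  define M where "M = direct_sum B (\<lambda>b. Hom MC x (?t b))"
  define u where "u = (\<lambda>v. \<lambda>b\<in>B. arrow_map R \<Gamma> (representable MC x) (?s b) v)"
  define v where "v = (\<lambda>w. \<Oplus>\<^bsub>Hom MC x y\<^esub> b\<in>B. arrow_map R \<Gamma> (representable MC x) b (w b))"
  \<comment> \<open>The value of the first map at the coset with coordinate
    \<open>d\<close>.\<close>
  define U where "U d = (\<lambda>b\<in>B. fiber x (?t b) (act x (?s b) d))" for d
  define K where "K = a_kernel M (Hom MC x y) v"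
  define L where "L = u ` carrier (Hom MC x (translation \<Gamma> y))"
  have H: "H = quotient_module (M\<lparr>carrier := K\<rparr>) L"
    by (simp add: H_def mesh_homology_def homology_def representable_def Let_def
        B_def M_def K_def L_def u_def v_def)
  interpret Q: stable_translation_quiver \<Gamma>
    by (rule stable_translation_quiver_repetitive_linear)
  have ty: "fst (translation \<Gamma> y) \<in> {1..n}" using y by (cases y) auto
  have finB: "finite B" using Q.finite_in_arcs[of y] y by (cases y) (auto simp: B_def)
  have B: "b \<in> arcs (quiver \<Gamma>)" "head (quiver \<Gamma>) b = y" "fst (?t b) \<in> {1..n}"
    "?s b \<in> arcs (quiver \<Gamma>)" "?t (?s b) = translation \<Gamma> y" "head (quiver \<Gamma>) (?s b) = ?t b"
    if "b \<in> B" for b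
    using that Q.tail_semitranslation[of b] Q.head_semitranslation[of b]
    by (cases b; auto simp: B_def in_arcs_def)+
  have uU: "u (fiber x (translation \<Gamma> y) d) = U d" if "d \<in> vals x (translation \<Gamma> y)" for d
    unfolding u_def U_def
  proof (rule restrict_ext)
    fix b assume "b \<in> B"
    then show "arrow_map R \<Gamma> (representable MC x) (?s b) (fiber x (translation \<Gamma> y) d) =
        fiber x (?t b) (act x (?s b) d)"
      using arrow_map_fiber[OF x B(4)[of b], of d] that B by simp
  qed
  have L: "L = U ` vals x (translation \<Gamma> y)"
    using uU by (force simp: L_def Hom_carrier[OF x ty])
  have actU: "act x (?s b) d \<in> vals x (?t b)" if "d \<in> vals x (translation \<Gamma> y)" "b \<in> B" for b d
    using act_vals[of d x "?s b"] vals_carrier[OF that(1)] B(6)[OF that(2)] by simp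
  have U_add: "U c \<oplus>\<^bsub>M\<^esub> U d = U (c \<oplus> d)"
    if "c \<in> vals x (translation \<Gamma> y)" "d \<in> vals x (translation \<Gamma> y)" for c d
    using that B(3) actU vals_carrier
    by (auto simp: M_def direct_sum_def U_def Hom_add[OF x] act_add intro!: restrict_ext)
  have v_fiber: "v (\<lambda>b\<in>B. fiber x (?t b) (c b)) = fiber x y (\<Oplus>b\<in>B. act x b (c b))
      \<and> (\<Oplus>b\<in>B. act x b (c b)) \<in> vals x y"
    if c: "\<And>b. b \<in> B \<Longrightarrow> c b \<in> vals x (?t b)" for c
  proof -
    interpret HH: abelian_group "Hom MC x y" by (rule abelian_group_Hom[OF x y])
    have a: "act x b (c b) \<in> vals x y" if "b \<in> B" for b
      using act_vals[of "c b" x b] c[OF that] vals_carrier B(2)[OF that] by simp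
    have "v (\<lambda>b\<in>B. fiber x (?t b) (c b)) =
        (\<Oplus>\<^bsub>Hom MC x y\<^esub> b\<in>B. fiber x y (act x b (c b)))"
      unfolding v_def
    proof (rule HH.finsum_cong')
      fix b assume b: "b \<in> B"
      then show "arrow_map R \<Gamma> (representable MC x) b ((\<lambda>b\<in>B. fiber x (?t b) (c b)) b) =
          fiber x y (act x b (c b))"
        using arrow_map_fiber[OF x B(1)[OF b] c[OF b]] B(2)[OF b] by simp
    qed (use a Hom_carrier[OF x y] in auto)
    then show ?thesis using Hom_finsum[OF x y finB, of "\<lambda>b. act x b (c b)"] a by simp
  qed
  \<comment> \<open>Elements of the direct sum are given by coordinates on \<open>B\<close>;
    injectivity of \<open>fiber\<close> turns the kernel condition into an equation in the
    ring.\<close>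
  have K_char: "k \<in> K \<longleftrightarrow> (\<exists>c. (\<forall>b\<in>B. c b \<in> vals x (?t b)) \<and> k = (\<lambda>b\<in>B. fiber x (?t b) (c b))
      \<and> (\<Oplus>b\<in>B. act x b (c b)) = \<zero>)" for k
  proof -
    have "k \<in> carrier M \<longleftrightarrow> (\<exists>c. (\<forall>b\<in>B. c b \<in> vals x (?t b)) \<and> k = (\<lambda>b\<in>B. fiber x (?t b) (c b)))"
    proof
      assume k: "k \<in> carrier M"
      then have "\<forall>b\<in>B. \<exists>c. c \<in> vals x (?t b) \<and> k b = fiber x (?t b) c"
        using B(3) by (auto simp: M_def direct_sum_def Hom_carrier[OF x] PiE_def Pi_def)
      then obtain c where "\<forall>b\<in>B. c b \<in> vals x (?t b) \<and> k b = fiber x (?t b) (c b)"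
        by metis
      moreover have "k = restrict k B"
        using k by (auto simp: M_def direct_sum_def PiE_restrict)
      ultimately show "\<exists>c. (\<forall>b\<in>B. c b \<in> vals x (?t b)) \<and> k = (\<lambda>b\<in>B. fiber x (?t b) (c b))"
        by (intro exI[of _ c]) (metis (no_types, lifting) restrict_ext)
    next
      assume "\<exists>c. (\<forall>b\<in>B. c b \<in> vals x (?t b)) \<and> k = (\<lambda>b\<in>B. fiber x (?t b) (c b))"
      then show "k \<in> carrier M"
        using B(3) by (auto simp: M_def direct_sum_def Hom_carrier[OF x])
    qed
    moreover have "k \<in> K \<longleftrightarrow> k \<in> carrier M \<and> v k = fiber x y \<zero>"
      by (simp add: K_def a_kernel_def' Hom_zero[OF x y])
    moreover have "v (\<lambda>b\<in>B. fiber x (?t b) (c b)) = fiber x y \<zero> \<longleftrightarrow> (\<Oplus>b\<in>B. act x b (c b)) = \<zero>"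
      if "\<forall>b\<in>B. c b \<in> vals x (?t b)" for c
      using v_fiber[of c] that fiber_inj[OF x, of _ y] by auto
    ultimately show ?thesis by blast
  qed
  have KL: "K \<subseteq> L"
  proof
    fix k assume "k \<in> K"
    then obtain c where c: "\<forall>b\<in>B. c b \<in> vals x (?t b)" "k = (\<lambda>b\<in>B. fiber x (?t b) (c b))"
      "(\<Oplus>b\<in>B. act x b (c b)) = \<zero>" using K_char by blast
    then obtain d where "d \<in> vals x (translation \<Gamma> y)" "\<forall>b\<in>B. act x (?s b) d = c b"
      using exact_at_middle[OF x y, of c] by (auto simp: B_def)
    then have "k = U d" using c(2) by (auto simp: U_def intro!: restrict_ext)
    then show "k \<in> L" using \<open>d \<in> _\<close> L by blast
  qed
  \<comment> \<open>The kernel is nonempty, so there is at least one coset.\<close>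
  have "(\<lambda>b\<in>B. fiber x (?t b) \<zero>) \<in> K"
    unfolding K_char by (intro exI[of _ "\<lambda>b. \<zero>"]) (simp add: finsum_zero)
  then have K: "K \<noteq> {}" by blast
  have coset: "L +>\<^bsub>M\<lparr>carrier := K\<rparr>\<^esub> k = L" if k: "k \<in> K" for k
  proof -
    obtain d where d: "d \<in> vals x (translation \<Gamma> y)" "k = U d" using k KL L by blast
    \<comment> \<open>Adding \<open>d\<close> permutes
      \<open>vals x (translation \<Gamma> y)\<close>, hence the coset is again all of
      \<open>L\<close>.\<close>
    have "L +>\<^bsub>M\<lparr>carrier := K\<rparr>\<^esub> k = (\<lambda>c. U (c \<oplus> d)) ` vals x (translation \<Gamma> y)"
      using U_add d by (force simp: a_r_coset_def' L)
    also have "\<dots> = L"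
    proof (intro Set.equalityI subsetI)
      fix w assume "w \<in> L"
      then obtain c where c: "c \<in> vals x (translation \<Gamma> y)" "w = U c" using L by blast
      have "c = (c \<oplus> (\<ominus> d)) \<oplus> d"
        using c(1) d(1) vals_carrier by (simp add: a_assoc l_neg)
      moreover have "c \<oplus> (\<ominus> d) \<in> vals x (translation \<Gamma> y)"
        using c(1) d(1) vals_add vals_uminus by blast
      ultimately show "w \<in> (\<lambda>c. U (c \<oplus> d)) ` vals x (translation \<Gamma> y)"
        using c(2) by (metis (no_types, lifting) image_eqI)
    qed (use d(1) vals_add L in blast)
    finally show ?thesis .
  qed
  have "carrier H = (\<Union>k\<in>K. {L})"
    using coset by (simp add: H quotient_module_def A_RCOSETS_def')
  then show ?thesis using K by (simp add: H quotient_module_def)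
qed

end

theorem theorem8p17:
  fixes R :: "('k, 'r) ring_scheme" and n :: nat
  assumes "cring R" and "\<one>\<^bsub>R\<^esub> \<noteq> \<zero>\<^bsub>R\<^esub>" and "n \<ge> 2"
  shows "normal_quiver R (repetitive_quiver (linear_quiver n))"
proof -
  interpret repetitive_linear R n
    using assms by (simp add: repetitive_linear_def repetitive_linear_axioms_def)
  show ?thesis
    unfolding normal_quiver_def Let_def
    by (intro ballI mesh_homology_trivial) auto
qed

end
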